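(* Let $n\ge 3$, let $q$ be a power of a prime $p>3$, and let $\mathcal{S}:F(X_0,\dots,X_n)=0\subset\mathbb{P}^n$ be an absolutely irreducible hypersurface of degree $d>2$, where $F\in\mathbb{F}_q[X_0,\dots,X_n]$ is a homogeneous polynomial of the form $$F(X_0,\dots,X_n)=G(X_0,X_1,X_2)+a_3X_3^d+\cdots+a_nX_n^d,$$ and suppose that $p\nmid d$ and that $\sum_{i=0}^n\frac{\partial F}{\partial X_i}X_i^q$ is a nonzero polynomial. Let $\mathcal{V}_i$ denote the hyperplane $X_i=0$, and assume that $\mathcal{V}:=\mathcal{S}\cap\mathcal{V}_3\cap\cdots\cap\mathcal{V}_n\subset\mathcal{S}_{\operatorname{reg}}$. If $\mathcal{S}$ is $\mathbb{F}_q$-Frobenius nonclassical, then $p\mid d-1$, and there exist an integer $r>0$ and homogeneous polynomials $A,B,C\in\mathbb{F}_q[X_0,X_1,X_2]$ of degree $(d-1)/p^r$ such that $$G(X_0,X_1,X_2)=A(X_0,X_1,X_2)^{p^r}X_0+B(X_0,X_1,X_2)^{p^r}X_1+C(X_0,X_1,X_2)^{p^r}X_2.$$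
   Context: $\mathcal{S}_{\operatorname{reg}}$ is the nonsingular locus of $\mathcal{S}$. $\Phi_q$ is the $\mathbb{F}_q$-Frobenius map (raising coordinates to the $q$-th power). A hypersurface $\mathcal{S}$ over $\mathbb{F}_q$ defined by $F$ is $\mathbb{F}_q$-Frobenius nonclassical if $\Phi_q(P)\in T_P(\mathcal{S})$ (the tangent hyperplane) for every $P\in\mathcal{S}_{\operatorname{reg}}$; equivalently, if $F$ divides $\sum_i\frac{\partial F}{\partial X_i}X_i^q$. *)

theory Defs
  imports
    "HOL-Library.Poly_Mapping"
    "HOL-Algebra.Algebraic_Closure_Type"
begin

section \<open>Multivariate polynomials\<close>

text \<open>
  Polynomials in the indeterminates \<open>X\<^sub>0, X\<^sub>1, X\<^sub>2, \<dots>\<close>: finitely supported maps from exponent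
  vectors to coefficients, with the convolution product of \<^theory>\<open>HOL-Library.Poly_Mapping\<close>.
  Membership in \<open>k[X\<^sub>i : i \<in> V]\<close> is expressed by \<open>poly_vars F \<subseteq> V\<close>.
\<close>

type_synonym 'a mpoly = "(nat \<Rightarrow>\<^sub>0 nat) \<Rightarrow>\<^sub>0 'a"

definition Var :: "nat \<Rightarrow> 'a::comm_semiring_1 mpoly" where
  "Var i = Poly_Mapping.single (Poly_Mapping.single i 1) 1"

definition Const :: "'a::comm_semiring_1 \<Rightarrow> 'a mpoly" where
  "Const c = Poly_Mapping.single 0 c"

definition poly_vars :: "'a::zero mpoly \<Rightarrow> nat set" where
  "poly_vars F = (\<Union>m\<in>Poly_Mapping.keys F. Poly_Mapping.keys m)"

definition monom_degree :: "(nat \<Rightarrow>\<^sub>0 nat) \<Rightarrow> nat" where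
  "monom_degree m = (\<Sum>i\<in>Poly_Mapping.keys m. Poly_Mapping.lookup m i)"

text \<open>The zero polynomial counts as homogeneous of every degree.\<close>

definition homogeneous_poly :: "nat \<Rightarrow> 'a::zero mpoly \<Rightarrow> bool" where
  "homogeneous_poly d F \<longleftrightarrow> (\<forall>m\<in>Poly_Mapping.keys F. monom_degree m = d)"

definition eval_poly :: "(nat \<Rightarrow> 'a::comm_semiring_1) \<Rightarrow> 'a mpoly \<Rightarrow> 'a" where
  "eval_poly x F =
     (\<Sum>m\<in>Poly_Mapping.keys F.
        Poly_Mapping.lookup F m * (\<Prod>i\<in>Poly_Mapping.keys m. x i ^ Poly_Mapping.lookup m i))"

text \<open>
  Monomials \<open>m\<close> not involving \<open>X\<^sub>i\<close> contribute zero, so the truncated subtraction of exponents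
  does no harm.
\<close>

definition partial_deriv :: "nat \<Rightarrow> 'a::comm_semiring_1 mpoly \<Rightarrow> 'a mpoly" where
  "partial_deriv i F =
     (\<Sum>m\<in>Poly_Mapping.keys F.
        Poly_Mapping.single (m - Poly_Mapping.single i 1)
          (of_nat (Poly_Mapping.lookup m i) * Poly_Mapping.lookup F m))"

definition to_ac_poly :: "'a::field mpoly \<Rightarrow> 'a alg_closure mpoly" where
  "to_ac_poly F = Poly_Mapping.map to_ac F"

text \<open>
  Irreducibility is taken in the polynomial ring in countably many indeterminates.  Over a field
  this agrees with irreducibility in \<open>k[X\<^sub>0, \<dots>, X\<^sub>n]\<close> whenever \<open>F\<close> lies in the latter ring, since
  the factors of a nonzero \<open>F\<close> involve only indeterminates occurring in \<open>F\<close>, and the units are the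
  nonzero constants in both rings.
\<close>

definition absolutely_irreducible :: "'a::field mpoly \<Rightarrow> bool" where
  "absolutely_irreducible F \<longleftrightarrow> Factorial_Ring.irreducible (to_ac_poly F)"


section \<open>Projective space and hypersurfaces\<close>

text \<open>
  A point of \<open>\<P>\<^sup>n\<close> is the set of all its homogeneous coordinate vectors \<open>(x\<^sub>0, \<dots>, x\<^sub>n)\<close>; a vector is
  a function on \<^typ>\<open>nat\<close> vanishing beyond \<open>n\<close>.
\<close>

definition hom_coords :: "nat \<Rightarrow> (nat \<Rightarrow> 'k::field) set" where
  "hom_coords n = {x. (\<forall>i>n. x i = 0) \<and> (\<exists>i\<le>n. x i \<noteq> 0)}"

definition proportional :: "nat \<Rightarrow> ((nat \<Rightarrow> 'k::field) \<times> (nat \<Rightarrow> 'k)) set" where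
  "proportional n =
     {(x, y). x \<in> hom_coords n \<and> y \<in> hom_coords n \<and> (\<exists>c. c \<noteq> 0 \<and> y = (\<lambda>i. c * x i))}"

definition proj_space :: "nat \<Rightarrow> (nat \<Rightarrow> 'k::field) set set" where
  "proj_space n = hom_coords n // proportional n"

definition hypersurface :: "nat \<Rightarrow> 'k::field mpoly \<Rightarrow> (nat \<Rightarrow> 'k) set set" where
  "hypersurface n F = {P \<in> proj_space n. \<forall>x\<in>P. eval_poly x F = 0}"

definition regular_locus :: "nat \<Rightarrow> 'k::field mpoly \<Rightarrow> (nat \<Rightarrow> 'k) set set" where
  "regular_locus n F =
     {P \<in> hypersurface n F. \<forall>x\<in>P. \<exists>i\<le>n. eval_poly x (partial_deriv i F) \<noteq> 0}"

definition tangent_hyperplane ::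
    "nat \<Rightarrow> 'k::field mpoly \<Rightarrow> (nat \<Rightarrow> 'k) set \<Rightarrow> (nat \<Rightarrow> 'k) set set" where
  "tangent_hyperplane n F P =
     {Q \<in> proj_space n. \<forall>x\<in>P. \<forall>y\<in>Q. (\<Sum>i\<le>n. eval_poly x (partial_deriv i F) * y i) = 0}"

text \<open>
  Over an algebraically closed field the coordinatewise image of a point under \<open>x \<mapsto> x\<^sup>q\<close> is again
  a full proportionality class.
\<close>

definition frobenius_map :: "nat \<Rightarrow> (nat \<Rightarrow> 'k::field) set \<Rightarrow> (nat \<Rightarrow> 'k) set" where
  "frobenius_map q P = (\<lambda>x i. x i ^ q) ` P"

lemma equiv_proportional:
  "equiv (hom_coords n :: (nat \<Rightarrow> 'k::field) set) (proportional n)" (is "equiv ?H ?R")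
proof (rule equivI)
  show "?R \<subseteq> ?H \<times> ?H"
    by (auto simp: proportional_def)
  show "refl_on ?H ?R"
    by (auto simp: refl_on_def proportional_def intro!: exI[of _ 1])
  show "sym ?R"
  proof (rule symI)
    fix x y :: "nat \<Rightarrow> 'k" assume "(x, y) \<in> ?R"
    then obtain c where "x \<in> hom_coords n" "y \<in> hom_coords n" "c \<noteq> 0" "y = (\<lambda>i. c * x i)"
      by (auto simp: proportional_def)
    moreover from this have "x = (\<lambda>i. inverse c * y i)"
      by (simp flip: mult.assoc)
    ultimately show "(y, x) \<in> ?R"
      unfolding proportional_def using nonzero_imp_inverse_nonzero by blast
  qed
  show "trans ?R"
  proof (rule transI)
    fix x y z :: "nat \<Rightarrow> 'k"
    assume "(x, y) \<in> ?R" "(y, z) \<in> ?R"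
    then obtain c c' where "x \<in> hom_coords n" "z \<in> hom_coords n" "c \<noteq> 0" "c' \<noteq> 0"
      "z = (\<lambda>i. c' * (c * x i))"
      by (auto simp: proportional_def)
    thus "(x, z) \<in> ?R"
      by (auto simp: proportional_def mult.assoc intro!: exI[of _ "c' * c"])
  qed
qed

lemma frobenius_map_in_proj_space:
  fixes P :: "(nat \<Rightarrow> 'k::alg_closed_field) set"
  assumes "P \<in> proj_space n" "q > 0"
  shows "frobenius_map q P \<in> proj_space n"
proof -
  from assms obtain x where x: "x \<in> hom_coords n" "P = proportional n `` {x}"
    by (auto simp: proj_space_def elim!: quotientE)
  define y where "y = (\<lambda>i. x i ^ q)"
  have y: "y \<in> hom_coords n"
    using x \<open>q > 0\<close> by (auto simp: y_def hom_coords_def)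
  have P: "P = {z. \<exists>c. c \<noteq> 0 \<and> z = (\<lambda>i. c * x i)}"
    using x by (auto simp: proportional_def hom_coords_def)
  have Y: "proportional n `` {y} = {z. \<exists>c. c \<noteq> 0 \<and> z = (\<lambda>i. c * y i)}"
    using y by (auto simp: proportional_def hom_coords_def)
  have "frobenius_map q P = proportional n `` {y}"
  proof (intro equalityI subsetI)
    fix z assume "z \<in> frobenius_map q P"
    then obtain c where "c \<noteq> 0" "z = (\<lambda>i. (c * x i) ^ q)"
      by (auto simp: frobenius_map_def P)
    thus "z \<in> proportional n `` {y}"
      unfolding Y by (auto simp: y_def power_mult_distrib intro!: exI[of _ "c ^ q"])
  next
    fix z assume "z \<in> proportional n `` {y}"
    then obtain c where c: "c \<noteq> 0" "z = (\<lambda>i. c * y i)" unfolding Y by auto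
    obtain b where b: "b ^ q = c" using nth_root_exists[OF \<open>q > 0\<close>] by blast
    have "b \<noteq> 0" using b c \<open>q > 0\<close> by auto
    have "z = (\<lambda>i. (b * x i) ^ q)"
      using b c by (simp add: y_def power_mult_distrib)
    moreover have "(\<lambda>i. b * x i) \<in> P" using \<open>b \<noteq> 0\<close> unfolding P by blast
    ultimately show "z \<in> frobenius_map q P"
      unfolding frobenius_map_def by (intro image_eqI[of _ _ "\<lambda>i. b * x i"]) auto
  qed
  thus ?thesis using y by (simp add: proj_space_def quotientI)
qed

text \<open>Points, regular locus and tangent hyperplanes are taken over the algebraic closure.\<close>

definition frobenius_nonclassical :: "nat \<Rightarrow> nat \<Rightarrow> 'a::field mpoly \<Rightarrow> bool" where
  "frobenius_nonclassical q n F \<longleftrightarrow>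
     (\<forall>P \<in> regular_locus n (to_ac_poly F).
        frobenius_map q P \<in> tangent_hyperplane n (to_ac_poly F) P)"

end

theory Submission
  imports Defs
begin

text \<open>
  Let \<open>K\<close> be the algebraic closure of \<open>\<F>\<^sub>q\<close> and let \<open>C\<close> be the plane curve \<open>G = 0\<close> over \<open>K\<close>, which is the
  section of the hypersurface by \<open>X\<^sub>3 = \<dots> = X\<^sub>n = 0\<close>.  At a point of \<open>C\<close> the partial derivatives
  \<open>d a\<^sub>i X\<^sub>i\<^sup>d\<^sup>-\<^sup>1\<close>, \<open>i \<ge> 3\<close>, vanish.  So regularity along the section says that \<open>C\<close> is smooth, and the tangency
  condition at these points says that \<open>\<Sum> G\<^sub>i(x) x\<^sub>i\<^sup>q = 0\<close> for all \<open>x \<in> C\<close>, where \<open>G\<^sub>i = \<partial>G/\<partial>X\<^sub>i\<close> and \<open>i \<le> 2\<close>.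
  Everything happens on this plane curve.

  The heart of the matter is that all second partial derivatives \<open>G\<^sub>i\<^sub>j\<close> vanish identically
  (\<open>smooth_frobenius_nonclassical_curve_hessian\<close>).  Write \<open>\<nabla>G = (G\<^sub>i)\<close> for the gradient and \<open>M = (G\<^sub>i\<^sub>j)\<close> for
  the Hessian matrix.  The polynomial \<open>\<Sum> G\<^sub>i X\<^sub>i\<^sup>q\<close> vanishes on \<open>C\<close>, so it is a multiple \<open>G \<eta>\<close> of \<open>G\<close>.
  Powers \<open>X\<^sub>i\<^sup>q\<close> have derivative zero, so differentiating this identity gives \<open>M x\<^sup>q = \<eta> \<nabla>G\<close> at each
  \<open>x \<in> C\<close>, and Euler's identity gives \<open>M x = (d - 1) \<nabla>G\<close>.  Both \<open>x\<close> and \<open>x\<^sup>q\<close> are orthogonal to \<open>\<nabla>G\<close>; unless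
  \<open>x\<close> is one of the finitely many \<open>\<F>\<^sub>q\<close>-rational points they span the orthogonal complement of \<open>\<nabla>G\<close>.  The
  quadratic form \<open>M\<close> is then zero on that complement, and as \<open>2 \<noteq> 0\<close> this means
  \<open>G\<^sub>i\<^sub>j = G\<^sub>i u\<^sub>j + u\<^sub>i G\<^sub>j\<close> for some vector \<open>u\<close> (\<open>hessian_symmetric_product\<close>).

  Because \<open>C\<close> is smooth, \<open>u\<^sub>j = (2 G\<^sub>i G\<^sub>i\<^sub>j - G\<^sub>j G\<^sub>i\<^sub>i) / (2 G\<^sub>i\<^sup>2)\<close> is regular on all of \<open>C\<close>, since at each point
  some \<open>G\<^sub>i\<close> can serve as denominator; it is homogeneous of degree \<open>(d - 2) - (d - 1) = -1\<close>.  But a plane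
  curve carries no nonzero section of \<open>\<O>(-1)\<close> (\<open>no_sections_of_negative_degree\<close>).  Hence \<open>u = 0\<close>, so \<open>G\<^sub>i\<^sub>j\<close>
  vanishes on \<open>C\<close>, and having degree \<open>d - 2 < d\<close> it is the zero polynomial.

  Finally, if \<open>m\<close> is an exponent vector of \<open>G\<close>, the vanishing of the Hessian gives \<open>p | m\<^sub>i m\<^sub>j\<close> for
  \<open>i \<noteq> j\<close> and \<open>p | m\<^sub>i (m\<^sub>i - 1)\<close>.  As \<open>m\<^sub>0 + m\<^sub>1 + m\<^sub>2 = d\<close> is prime to \<open>p\<close>, exactly one \<open>m\<^sub>i\<close> is prime to
  \<open>p\<close>, and it is \<open>1\<close> modulo \<open>p\<close>.  So \<open>p | d - 1\<close>, each monomial is \<open>X\<^sub>i\<close> times a \<open>p\<close>-th power, and as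
  \<open>\<F>\<^sub>q\<close> is perfect one obtains the required shape of \<open>G\<close> with \<open>r = 1\<close>.
\<close>


section \<open>Polynomials in two variables over an algebraically closed field\<close>

text \<open>
  This makes \<open>K[s][z]\<close> a factorial ring for the algebraic closure \<open>K\<close>.
\<close>

instance alg_closure :: (field) field_gcd ..

text \<open>
  Over a finite field \<open>1 + \<Prod> (X - a)\<close>, the product running over all elements, has no root.
\<close>

lemma infinite_alg_closed: "infinite (UNIV :: 'k::alg_closed_field set)"
proof
  assume fin: "finite (UNIV :: 'k set)"
  define P where "P = (\<Prod>a\<in>(UNIV::'k set). [:-a, 1:])"
  have "degree P = card (UNIV :: 'k set)"
    unfolding P_def by (subst degree_prod_eq_sum_degree) auto
  hence "degree P > 0" using fin by (simp add: card_gt_0_iff)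
  hence "degree (P + 1) > 0" by (simp add: degree_add_eq_left)
  then obtain x where "poly (P + 1) x = 0" using alg_closed_imp_poly_has_root by blast
  moreover have "poly P x = 0" unfolding P_def poly_prod using fin by (intro prod_zero) auto
  ultimately show False by simp
qed

lemma map_poly_add_hom:
  assumes "f 0 = 0" "\<And>x y. f (x + y) = f x + f y"
  shows "map_poly f (p + q) = map_poly f p + map_poly f q"
  by (rule poly_eqI) (simp add: coeff_map_poly assms)

lemma map_poly_mult_hom:
  fixes f :: "'a::comm_semiring_0 \<Rightarrow> 'b::comm_semiring_0"
  assumes "f 0 = 0" "\<And>x y. f (x + y) = f x + f y" "\<And>x y. f (x * y) = f x * f y"
  shows "map_poly f (p * q) = map_poly f p * map_poly f q"
proof (rule poly_eqI)
  have sum: "f (sum g A) = (\<Sum>x\<in>A. f (g x))" if "finite A" for g :: "nat \<Rightarrow> 'a" and A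
    using that by (induction rule: finite_induct) (simp_all add: assms)
  show "coeff (map_poly f (p * q)) n = coeff (map_poly f p * map_poly f q) n" for n
    by (simp add: coeff_map_poly assms coeff_mult sum)
qed

text \<open>
  An element of \<open>K[s][z]\<close> is a function on the plane with coordinates \<open>s\<close> and \<open>z\<close>; this is its restriction
  to the vertical line on which the first coordinate has a given value, as a polynomial in \<open>z\<close>.
\<close>

definition fibre :: "'k::comm_semiring_1 \<Rightarrow> 'k poly poly \<Rightarrow> 'k poly" where
  "fibre s f = map_poly (\<lambda>r. poly r s) f"

lemma coeff_fibre: "coeff (fibre s f) n = poly (coeff f n) s"
  by (simp add: fibre_def coeff_map_poly)

lemma fibre_0 [simp]: "fibre s 0 = 0" and fibre_1 [simp]: "fibre s 1 = 1"
  and fibre_add: "fibre s (f + g) = fibre s f + fibre s g"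
  and fibre_mult: "fibre s (f * g) = fibre s f * fibre s g"
  and fibre_const [simp]: "fibre s [:r:] = [:poly r s:]"
  by (simp_all add: fibre_def map_poly_add_hom map_poly_mult_hom map_poly_pCons)

lemma fibre_diff: "fibre s (f - g) = fibre s f - fibre s (g :: 'k::comm_ring_1 poly poly)"
  by (rule poly_eqI) (simp add: coeff_fibre)

lemma fibre_sum: "fibre s (sum f A) = (\<Sum>x\<in>A. fibre s (f x))"
  by (induction A rule: infinite_finite_induct) (simp_all add: fibre_add)

lemma poly_fibre: "poly (fibre s f) z = poly (poly f [:z:]) (s :: 'k::comm_ring_1)"
  by (induction f) (simp_all add: fibre_def map_poly_pCons)

lemma fibre_eq_0_iff: "fibre s f = 0 \<longleftrightarrow> [:[:-s, 1:]:] dvd (f :: 'k::{field} poly poly)"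
  by (simp add: const_poly_dvd_iff poly_eq_0_iff_dvd[symmetric] poly_eq_iff coeff_fibre)

lemma degree_fibre:
  assumes "is_unit (lead_coeff (f :: 'k::field poly poly))"
  shows "degree (fibre s f) = degree f" "fibre s f \<noteq> 0"
proof -
  from assms obtain c where c: "lead_coeff f = [:c:]" "c \<noteq> 0"
    by (metis is_unit_poly_iff dvd_field_iff dvd_0_left_iff is_unit_pCons_iff)
  hence *: "coeff (fibre s f) (degree f) \<noteq> 0" by (simp add: coeff_fibre)
  thus "fibre s f \<noteq> 0" by auto
  have "degree (fibre s f) \<le> degree f" by (intro degree_le) (simp add: coeff_fibre coeff_eq_0)
  with * show "degree (fibre s f) = degree f" by (simp add: le_antisym le_degree)
qed

lemma division_unit_lead_coeff:
  fixes f g :: "'k::field poly poly"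
  assumes lc: "is_unit (lead_coeff g)"
  obtains q r where "f = g * q + r" "r = 0 \<or> degree r < degree g"
proof -
  have g: "g \<noteq> 0" using lc by auto
  obtain q r where qr: "pseudo_divmod f g = (q, r)" by fastforce
  define e where "e = Suc (degree f) - degree g"
  from lc obtain b where b: "1 = lead_coeff g * b" by (auto elim: dvdE)
  have "smult (lead_coeff g ^ e) f = g * q + r" and r: "r = 0 \<or> degree r < degree g"
    using pseudo_divmod[OF g qr] by (simp_all add: e_def)
  hence "smult (b ^ e) (smult (lead_coeff g ^ e) f) = smult (b ^ e) (g * q + r)" by simp
  also have "smult (b ^ e) (smult (lead_coeff g ^ e) f) = f"
    using b by (simp add: power_mult_distrib[symmetric] mult.commute)
  finally have "f = g * smult (b ^ e) q + smult (b ^ e) r" by (simp add: smult_add_right)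
  moreover have "smult (b ^ e) r = 0 \<or> degree (smult (b ^ e) r) < degree g"
    using r by auto
  ultimately show ?thesis by (rule that)
qed

lemma unit_lead_coeff_dvd:
  fixes c g :: "'a::{idom, algebraic_semidom} poly"
  assumes "c dvd g" "is_unit (lead_coeff g)"
  shows "is_unit (lead_coeff c)"
proof -
  from assms(1) obtain k where "g = c * k" by (rule dvdE)
  hence "lead_coeff c dvd lead_coeff g" by (simp add: lead_coeff_mult)
  thus ?thesis using assms(2) by (rule dvd_trans)
qed

text \<open>
  The stand-in for the resultant.  Over \<open>K(s)\<close> the ideal of \<open>g\<close> and \<open>h\<close> is generated by any nonzero combination
  \<open>w\<close> of least degree, and pseudo-division shows this without leaving \<open>K[s][z]\<close>: \<open>w\<close> divides \<open>g\<close> and \<open>h\<close> up to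
  nonzero factors from \<open>K[s]\<close>.  A common divisor has degree zero in \<open>z\<close>, so \<open>w\<close> itself lies in \<open>K[s]\<close>.
\<close>

lemma elimination:
  fixes g h :: "'k::field_gcd poly poly"
  assumes g: "g \<noteq> 0" and deg: "degree (gcd g h) = 0"
  shows "\<exists>A B R. R \<noteq> 0 \<and> A * g + B * h = [:R:]"
proof -
  define P where "P w \<longleftrightarrow> w \<noteq> 0 \<and> (\<exists>A B. w = A * g + B * h)" for w
  have "P g" unfolding P_def using g by (intro conjI exI[of _ 1] exI[of _ 0]) auto
  then obtain w where w: "P w" "\<And>y. P y \<Longrightarrow> degree w \<le> degree y"
    using ex_has_least_nat[of P g degree] by blast
  then obtain A B where AB: "w = A * g + B * h" and w0: "w \<noteq> 0" unfolding P_def by auto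
  have div: "\<exists>c. c \<noteq> 0 \<and> w dvd smult c f" if f: "f = g \<or> f = h" for f
  proof -
    obtain c q where cq: "c \<noteq> 0" "smult c f = w * q + pseudo_mod f w"
      using pseudo_mod(1)[OF w0, of f] by blast
    have "\<exists>A' B'. pseudo_mod f w = A' * g + B' * h"
    proof -
      from f have "\<exists>A' B'. smult c f = A' * g + B' * h"
      proof
        assume "f = g" thus ?thesis by (intro exI[of _ "[:c:]"] exI[of _ 0]) simp
      next
        assume "f = h" thus ?thesis by (intro exI[of _ "[:c:]"] exI[of _ 0]) simp
      qed
      then obtain A' B' where "smult c f = A' * g + B' * h" by blast
      hence "pseudo_mod f w = (A' - q * A) * g + (B' - q * B) * h"
        using cq(2) AB by (simp add: algebra_simps)
      thus ?thesis by blast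
    qed
    hence "pseudo_mod f w = 0"
      using pseudo_mod(2)[OF w0, of f] w(2)[of "pseudo_mod f w"] unfolding P_def by force
    thus ?thesis using cq by auto
  qed
  obtain c1 where c1: "c1 \<noteq> 0" "w dvd smult c1 g" using div by blast
  obtain c2 where c2: "c2 \<noteq> 0" "w dvd smult c2 h" using div by blast
  have "smult (c1 * c2) g = smult c2 (smult c1 g)" "smult (c1 * c2) h = smult c1 (smult c2 h)"
    by (simp_all add: mult.commute)
  hence "w dvd [:c1 * c2:] * g" "w dvd [:c1 * c2:] * h"
    using c1(2) c2(2) by (simp_all add: dvd_smult del: smult_smult)
  hence "w dvd gcd ([:c1 * c2:] * g) ([:c1 * c2:] * h)" by simp
  hence "w dvd [:c1 * c2:] * gcd g h" by (simp only: gcd_mult_left dvd_normalize_iff)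
  moreover have "[:c1 * c2:] * gcd g h \<noteq> 0" using c1 c2 g by simp
  ultimately have "degree w \<le> degree ([:c1 * c2:] * gcd g h)" by (rule dvd_imp_degree_le)
  also have "\<dots> = 0" using deg c1 c2 by simp
  finally have "degree w = 0" by simp
  then obtain R where "w = [:R:]" by (metis degree_eq_zeroE)
  with AB w0 show ?thesis by (intro exI[of _ A] exI[of _ B] exI[of _ R]) auto
qed


text \<open>
  A prime factor \<open>c\<close> of \<open>g\<close> that does not divide \<open>h\<close> would give \<open>A c + B h = R(s) \<noteq> 0\<close>.  As \<open>c\<close> has constant
  leading coefficient, it has a zero on every vertical line, and there \<open>R\<close> must vanish as well.
  Finitely many exceptional lines \<open>E\<close> do no harm; they will be the lines through the rational points.
\<close>

lemma plane_nullstellensatz: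
  fixes g h :: "'k::{alg_closed_field, field_gcd} poly poly"
  assumes lc: "is_unit (lead_coeff g)"
    and sqf: "\<And>c. c ^ 2 dvd g \<Longrightarrow> is_unit c"
    and fin: "finite E"
    and van: "\<And>s z. s \<notin> E \<Longrightarrow> poly (poly g [:z:]) s = 0 \<Longrightarrow> poly (poly h [:z:]) s = 0"
  shows "g dvd h"
proof (cases "h = 0")
  case False
  have g: "g \<noteq> 0" using lc by auto
  have prime_dvd: "c dvd h" if c: "prime c" "c dvd g" for c
  proof (rule ccontr)
    assume "\<not> c dvd h"
    hence "coprime c h" using c(1) by (simp add: prime_imp_coprime)
    hence deg: "degree (gcd c h) = 0" by (simp add: coprime_iff_gcd_eq_1)
    have "c \<noteq> 0" using c by auto
    from elimination[OF this deg] obtain A B R where R: "R \<noteq> 0" "A * c + B * h = [:R:]"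
      by blast
    have lcc: "is_unit (lead_coeff c)"
      by (rule unit_lead_coeff_dvd[OF c(2) lc])
    have "degree c > 0"
    proof (rule ccontr)
      assume "\<not> degree c > 0"
      then obtain r where "c = [:r:]" using degree_eq_zeroE by blast
      hence "is_unit c" using lcc by (simp add: is_unit_const_poly_iff)
      thus False using c(1) by (simp add: not_prime_unit)
    qed
    have "poly R s = 0" if s: "s \<notin> E" for s
    proof -
      have "degree (fibre s c) > 0" using degree_fibre[OF lcc] \<open>degree c > 0\<close> by simp
      then obtain z where z: "poly (fibre s c) z = 0" using alg_closed_imp_poly_has_root by blast
      hence c0: "poly (poly c [:z:]) s = 0" by (simp add: poly_fibre)
      hence "poly (poly g [:z:]) s = 0" using c(2) by (auto elim!: dvdE)
      hence h0: "poly (poly h [:z:]) s = 0" using van s by blast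
      have "poly (poly [:R:] [:z:]) s = 0"
        by (subst R(2)[symmetric]) (simp add: c0 h0)
      thus ?thesis by simp
    qed
    hence "UNIV - E \<subseteq> {s. poly R s = 0}" by blast
    moreover have "infinite (UNIV - E)" using infinite_alg_closed fin by simp
    ultimately show False using poly_roots_finite[OF R(1)] finite_subset by blast
  qed
  show ?thesis
  proof (rule multiplicity_le_imp_dvd)
    fix c :: "'k poly poly" assume c: "prime c"
    show "multiplicity c g \<le> multiplicity c h"
    proof (cases "c dvd g")
      case True
      have "\<not> c ^ 2 dvd g" using sqf[of c] c not_prime_unit by blast
      hence "multiplicity c g < 2" using g c by (metis multiplicity_dvd' not_less)
      moreover have "multiplicity c h \<ge> 1"
        using prime_dvd[OF c True] False c by (intro multiplicity_geI) auto
      ultimately show ?thesis by linarith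
    qed (simp add: not_dvd_imp_multiplicity_0)
  qed (use g in auto)
qed simp

text \<open>
  A nonzero combination of least degree divides all the given polynomials, hence is a constant.
\<close>

lemma bezout_of_no_common_root:
  fixes g :: "'k::alg_closed_field poly" and D :: "'i \<Rightarrow> 'k poly"
  assumes I: "finite I" and g: "g \<noteq> 0"
    and nocommon: "\<And>z. poly g z = 0 \<Longrightarrow> \<exists>i\<in>I. poly (D i) z \<noteq> 0"
  shows "\<exists>e e'. e' * g + (\<Sum>i\<in>I. e i * D i) = 1"
proof -
  define P where "P w \<longleftrightarrow> w \<noteq> 0 \<and> (\<exists>e e'. w = e' * g + (\<Sum>i\<in>I. e i * D i))" for w
  have "P g" unfolding P_def using g by (intro conjI exI[of _ 1] exI[of _ "\<lambda>_. 0"]) auto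
  then obtain w where w: "P w" "\<And>y. P y \<Longrightarrow> degree w \<le> degree y"
    using ex_has_least_nat[of P g degree] by blast
  then obtain e e' where ee: "w = e' * g + (\<Sum>i\<in>I. e i * D i)" and w0: "w \<noteq> 0"
    unfolding P_def by auto
  have div: "w dvd f" if f: "f = f' * g + (\<Sum>i\<in>I. k i * D i)" for f f' k
  proof -
    define m where "m = f div w"
    have "f mod w = f - m * w" by (simp add: m_def minus_div_mult_eq_mod)
    also have "\<dots> = (f' - m * e') * g + (\<Sum>i\<in>I. (k i - m * e i) * D i)"
      unfolding f ee by (simp add: algebra_simps sum_subtractf sum_distrib_left)
    finally have "\<exists>k k'. f mod w = k' * g + (\<Sum>i\<in>I. k i * D i)"
      by (rule exI[of _ "\<lambda>i. k i - m * e i", OF exI[of _ "f' - m * e'"]])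
    hence "f mod w \<noteq> 0 \<Longrightarrow> P (f mod w)" unfolding P_def by simp
    hence "f mod w = 0 \<or> degree w \<le> degree (f mod w)" using w(2) by metis
    hence "f mod w = 0" using degree_mod_less[OF w0, of f] by auto
    thus ?thesis by auto
  qed
  have wg: "w dvd g" by (rule div[of _ 1 "\<lambda>_. 0"]) simp
  have wD: "w dvd D i" if "i \<in> I" for i
  proof (rule div[of _ 0 "\<lambda>j. if j = i then 1 else 0"])
    have "(\<Sum>j\<in>I. (if j = i then 1 else 0) * D j) = (\<Sum>j\<in>I. if j = i then D j else 0)"
      by (intro sum.cong) auto
    thus "D i = 0 * g + (\<Sum>j\<in>I. (if j = i then 1 else 0) * D j)" using that I by simp
  qed
  have "degree w = 0"
  proof (rule ccontr)
    assume "degree w \<noteq> 0"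
    then obtain z where "poly w z = 0" using alg_closed_imp_poly_has_root by blast
    with wg wD nocommon[of z] show False by (metis dvd_trans poly_eq_0_iff_dvd)
  qed
  then obtain c where c: "w = [:c:]" "c \<noteq> 0" using w0 by (metis degree_eq_zeroE pCons_0_0)
  have "[:1 / c:] * w = ([:1 / c:] * e') * g + (\<Sum>i\<in>I. ([:1 / c:] * e i) * D i)"
    unfolding ee by (simp only: distrib_left sum_distrib_left mult.assoc)
  moreover have "[:1 / c:] * w = 1" using c by simp
  ultimately show ?thesis
    by (intro exI[of _ "\<lambda>i. [:1 / c:] * e i"] exI[of _ "[:1 / c:] * e'"]) simp
qed


text \<open>
  The fractions \<open>N i / D i\<close> agree on the affine curve \<open>g = 0\<close>, and at every point one of the denominators is
  nonzero; so they glue to a regular function, which is here shown to be induced by a polynomial \<open>u\<close>.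

  A common denominator \<open>r \<in> K[s]\<close> exists: choose a combination \<open>D'\<close> of the \<open>D i\<close> that is \<open>1\<close> on one vertical
  fibre of the curve; it has no common factor with \<open>g\<close>, so \<open>elimination\<close> applies.  If a common denominator of least
  degree had a root \<open>s\<close>, then \<open>u\<close> would be killed by all \<open>D i\<close> on the fibre above \<open>s\<close>, hence vanish there, and
  the corresponding linear factor could be cancelled.
\<close>

lemma glue_fractions:
  fixes g :: "'k::{alg_closed_field, field_gcd} poly poly"
    and D N :: "'i \<Rightarrow> 'k poly poly"
  assumes I: "finite I" and lc: "is_unit (lead_coeff g)"
    and nocommon: "\<And>s z. poly (poly g [:z:]) s = 0 \<Longrightarrow> \<exists>i\<in>I. poly (poly (D i) [:z:]) s \<noteq> 0"
    and cross: "\<And>i j. i \<in> I \<Longrightarrow> j \<in> I \<Longrightarrow> g dvd D i * N j - D j * N i"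
  obtains u where "u = 0 \<or> degree u < degree g" "\<And>i. i \<in> I \<Longrightarrow> g dvd D i * u - N i"
proof -
  define P where "P r \<longleftrightarrow> r \<noteq> 0 \<and> (\<exists>u. \<forall>i\<in>I. g dvd D i * u - [:r:] * N i)" for r
  have g0: "g \<noteq> 0" using lc by auto
  have bez: "\<exists>e e'. e' * fibre s g + (\<Sum>i\<in>I. e i * fibre s (D i)) = 1" for s
  proof -
    have "\<exists>i\<in>I. poly (fibre s (D i)) z \<noteq> 0" if "poly (fibre s g) z = 0" for z
      using that nocommon[of z s] by (simp add: poly_fibre)
    thus ?thesis by (rule bezout_of_no_common_root[OF I degree_fibre(2)[OF lc]])
  qed
  have reduce: "\<exists>v. (v = 0 \<or> degree v < degree g) \<and> (\<forall>i\<in>I. g dvd D i * v - w i)"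
    if u: "\<forall>i\<in>I. g dvd D i * u - w i" for u w
  proof -
    obtain q v where qv: "u = g * q + v" "v = 0 \<or> degree v < degree g"
      using division_unit_lead_coeff[OF lc] by blast
    have "g dvd D i * v - w i" if "i \<in> I" for i
    proof -
      have "D i * v - w i = (D i * u - w i) - g * (D i * q)" by (simp add: qv(1) algebra_simps)
      also have "g dvd \<dots>"
        using u that by (intro dvd_diff[of g "D i * u - w i"]) auto
      finally show ?thesis .
    qed
    thus ?thesis using qv(2) by blast
  qed
  have "\<exists>r. P r"
  proof -
    obtain e e' where ee: "e' * fibre 0 g + (\<Sum>i\<in>I. e i * fibre 0 (D i)) = 1" using bez by blast
    define E where "E i = map_poly (\<lambda>c. [:c:]) (e i)" for i
    have spE: "fibre 0 (E i) = e i" for i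
      by (rule poly_eqI) (simp add: coeff_fibre E_def coeff_map_poly)
    define D' where "D' = (\<Sum>i\<in>I. E i * D i)"
    have spD': "e' * fibre 0 g + fibre 0 D' = 1"
      using ee by (simp add: D'_def fibre_sum fibre_mult spE)
    have deg: "degree (gcd g D') = 0"
    proof (rule ccontr)
      define c where "c = gcd g D'"
      assume "degree (gcd g D') \<noteq> 0"
      hence "degree c > 0" by (simp add: c_def)
      have cg: "c dvd g" "c dvd D'" by (simp_all add: c_def)
      have lcc: "is_unit (lead_coeff c)"
        by (rule unit_lead_coeff_dvd[OF cg(1) lc])
      have "degree (fibre 0 c) > 0" using degree_fibre[OF lcc] \<open>degree c > 0\<close> by simp
      then obtain z where z: "poly (fibre 0 c) z = 0" using alg_closed_imp_poly_has_root by blast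
      have "poly (fibre 0 g) z = 0" "poly (fibre 0 D') z = 0"
        using cg z by (auto elim!: dvdE simp: fibre_mult)
      hence "poly (e' * fibre 0 g + fibre 0 D') z = 0" by simp
      thus False unfolding spD' by simp
    qed
    from elimination[OF g0 deg] obtain A B R where R: "R \<noteq> 0" "A * g + B * D' = [:R:]"
      by blast
    define u where "u = B * (\<Sum>i\<in>I. E i * N i)"
    have "g dvd D j * u - [:R:] * N j" if j: "j \<in> I" for j
    proof -
      have eq: "(\<Sum>i\<in>I. E i * (D j * N i - D i * N j)) = D j * (\<Sum>i\<in>I. E i * N i) - D' * N j"
        unfolding D'_def by (simp add: algebra_simps sum_subtractf sum_distrib_left sum_distrib_right)
      have "D j * u - [:R:] * N j
          = B * (\<Sum>i\<in>I. E i * (D j * N i - D i * N j)) - g * (A * N j)"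
        unfolding eq R(2)[symmetric] u_def by (simp add: algebra_simps)
      moreover have "g dvd (\<Sum>i\<in>I. E i * (D j * N i - D i * N j))"
        using cross j by (intro dvd_sum dvd_mult) auto
      ultimately show ?thesis by simp
    qed
    hence "P R" unfolding P_def using R by blast
    thus ?thesis by blast
  qed
  then obtain r where r: "P r" "\<And>y. P y \<Longrightarrow> degree r \<le> degree y"
    using ex_has_least_nat[of P _ degree] by blast
  then obtain u where r0: "r \<noteq> 0" and u: "\<forall>i\<in>I. g dvd D i * u - [:r:] * N i"
    unfolding P_def by auto
  have "degree r = 0"
  proof (rule ccontr)
    assume "degree r \<noteq> 0"
    then obtain s where s: "poly r s = 0" using alg_closed_imp_poly_has_root by blast
    then obtain r' where r': "r = [:-s, 1:] * r'" unfolding poly_eq_0_iff_dvd by (rule dvdE)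
    obtain v where v: "v = 0 \<or> degree v < degree g" "\<forall>i\<in>I. g dvd D i * v - [:r:] * N i"
      using reduce[OF u] by blast
    obtain e e' where ee: "e' * fibre s g + (\<Sum>i\<in>I. e i * fibre s (D i)) = 1" using bez by blast
    have "fibre s g dvd fibre s (D i) * fibre s v" if "i \<in> I" for i
    proof -
      from v(2) that obtain k where "D i * v - [:r:] * N i = g * k" by (meson dvdE)
      hence "fibre s (D i * v - [:r:] * N i) = fibre s (g * k)" by simp
      hence "fibre s (D i) * fibre s v = fibre s g * fibre s k"
        by (simp only: fibre_diff fibre_mult fibre_const s) simp
      thus ?thesis by simp
    qed
    hence "fibre s g dvd (\<Sum>i\<in>I. e i * (fibre s (D i) * fibre s v)) + fibre s g * (e' * fibre s v)"
      by (intro dvd_add[OF dvd_sum[OF dvd_mult] dvd_triv_left])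
    also have "\<dots> = (e' * fibre s g + (\<Sum>i\<in>I. e i * fibre s (D i))) * fibre s v"
      by (simp add: algebra_simps sum_distrib_left)
    finally have dvdv: "fibre s g dvd fibre s v" by (simp add: ee)
    have "fibre s v = 0"
    proof (rule ccontr)
      assume nz: "fibre s v \<noteq> 0"
      have "degree (fibre s v) \<le> degree v" by (intro degree_le) (simp add: coeff_fibre coeff_eq_0)
      with dvd_imp_degree_le[OF dvdv nz] degree_fibre(1)[OF lc, of s] v(1) nz show False by auto
    qed
    then obtain v' where v': "v = [:[:-s, 1:]:] * v'" unfolding fibre_eq_0_iff by (rule dvdE)
    have "g dvd D i * v' - [:r':] * N i" if i: "i \<in> I" for i
    proof -
      from v(2) i obtain k where k: "D i * v - [:r:] * N i = g * k" by (meson dvdE)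
      have eq: "D i * v - [:r:] * N i = [:[:-s, 1:]:] * (D i * v' - [:r':] * N i)"
        unfolding v' r' by (simp add: algebra_simps smult_add_right)
      have "fibre s (g * k) = 0" by (simp add: k[symmetric] eq fibre_eq_0_iff del: mult_pCons_left)
      hence "fibre s k = 0" using degree_fibre(2)[OF lc, of s] by (simp add: fibre_mult)
      then obtain k' where "k = [:[:-s, 1:]:] * k'" unfolding fibre_eq_0_iff by (rule dvdE)
      hence "[:[:-s, 1:]:] * (D i * v' - [:r':] * N i) = [:[:-s, 1:]:] * (g * k')"
        using k eq by (simp add: mult.left_commute del: mult_pCons_left)
      hence "D i * v' - [:r':] * N i = g * k'"
        by (subst (asm) mult_cancel_left) simp
      thus ?thesis by simp
    qed
    moreover have "r' \<noteq> 0" using r0 r' by auto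
    ultimately have "degree r \<le> degree r'" by (intro r(2)) (auto simp: P_def)
    moreover have "degree r = Suc (degree r')"
      using \<open>r' \<noteq> 0\<close> unfolding r' by (subst degree_mult_eq) auto
    ultimately show False by simp
  qed
  then obtain c where c: "r = [:c:]" "c \<noteq> 0" using r0 by (metis degree_eq_zeroE pCons_0_0)
  have "\<forall>i\<in>I. g dvd D i * ([:[:1 / c:]:] * u) - N i"
  proof
    fix i assume "i \<in> I"
    hence "g dvd [:[:1 / c:]:] * (D i * u - [:r:] * N i)" using u by (intro dvd_mult) auto
    also have "\<dots> = D i * ([:[:1 / c:]:] * u) - N i"
      using c by (simp add: smult_diff_right flip: one_pCons)
    finally show "g dvd D i * ([:[:1 / c:]:] * u) - N i" .
  qed
  from reduce[OF this] show ?thesis using that by blast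
qed


section \<open>Plane curves have no sections of negative degree\<close>

definition lift_const :: "'k::comm_semiring_1 poly \<Rightarrow> 'k poly poly" where
  "lift_const r = map_poly (\<lambda>c. [:c:]) r"

text \<open>
  The substitution \<open>s \<mapsto> t\<close>, \<open>z \<mapsto> t w\<close> into \<open>K[w][t]\<close>.  It turns the total degree of a polynomial in \<open>s\<close> and \<open>z\<close>
  into the degree in \<open>t\<close>, and the leading form, which describes the behaviour at infinity, into the leading
  coefficient, a polynomial in the slope \<open>w\<close>.
\<close>

definition dilate :: "'k::comm_semiring_1 poly poly \<Rightarrow> 'k poly poly" where
  "dilate f = poly (map_poly lift_const f) [:0, [:0, 1:]:]"

lemma coeff_lift_const: "coeff (coeff (lift_const r) n) k = (if k = 0 then coeff r n else 0)"
  by (simp add: lift_const_def coeff_map_poly coeff_pCons split: nat.splits)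

lemma lift_const_0 [simp]: "lift_const 0 = 0" by (simp add: lift_const_def)

lemma lift_const_add: "lift_const (r + t) = lift_const r + lift_const t"
  unfolding lift_const_def by (rule map_poly_add_hom) simp_all

lemma lift_const_mult: "lift_const (r * t) = lift_const r * lift_const t"
  unfolding lift_const_def by (rule map_poly_mult_hom) (simp_all add: mult.commute)

lemma dilate_0 [simp]: "dilate 0 = 0"
  by (simp add: dilate_def)

lemma dilate_pCons: "dilate (pCons r f) = lift_const r + [:0, [:0, 1:]:] * dilate f"
  by (simp add: dilate_def map_poly_pCons)

lemma dilate_add: "dilate (f + h) = dilate f + dilate h"
  unfolding dilate_def by (subst map_poly_add_hom) (simp_all add: lift_const_add)

lemma dilate_mult: "dilate (f * h) = dilate f * dilate h"
  unfolding dilate_def by (subst map_poly_mult_hom) (simp_all add: lift_const_add lift_const_mult)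

lemma dilate_diff: "dilate (f - h) = dilate f - dilate (h :: 'k::comm_ring_1 poly poly)"
  using dilate_add[of "f - h" h] by simp

lemma coeff_dilate: "coeff (coeff (dilate f) n) k = (if k \<le> n then coeff (coeff f k) (n - k) else 0)"
proof (induction f arbitrary: n k)
  case (pCons r f)
  show ?case
  proof (cases n)
    case 0
    thus ?thesis by (simp add: dilate_pCons coeff_lift_const)
  next
    case (Suc m)
    have "coeff (coeff (dilate (pCons r f)) n) k
        = coeff (coeff (lift_const r) n) k + coeff ([:0, 1:] * coeff (dilate f) m) k"
      by (simp add: dilate_pCons Suc)
    also have "coeff ([:0, 1:] * coeff (dilate f) m) k
        = (case k of 0 \<Rightarrow> 0 | Suc l \<Rightarrow> coeff (coeff (dilate f) m) l)"
      by (simp add: coeff_pCons)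
    finally show ?thesis by (simp add: pCons.IH coeff_lift_const Suc coeff_pCons split: nat.splits)
  qed
qed simp

lemma dilate_eq_0_iff: "dilate f = 0 \<longleftrightarrow> f = 0"
proof
  assume "dilate f = 0"
  hence "coeff (coeff f k) m = 0" for k m using coeff_dilate[of f "k + m" k] by simp
  thus "f = 0" by (simp add: poly_eq_iff)
qed simp

lemma degree_coeff_dilate: "degree (coeff (dilate f) n) \<le> min n (degree f)"
  by (intro degree_le) (auto simp: coeff_dilate coeff_eq_0)

lemma coeff_mult_top:
  fixes p q :: "'a::comm_semiring_0 poly"
  assumes "degree p \<le> m" "degree q \<le> n"
  shows "coeff (p * q) (m + n) = coeff p m * coeff q n"
proof -
  have "coeff (p * q) (m + n) = (\<Sum>i\<le>m + n. coeff p i * coeff q (m + n - i))"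
    by (simp add: coeff_mult)
  also have "\<dots> = (\<Sum>i\<le>m + n. if i = m then coeff p m * coeff q n else 0)"
  proof (intro sum.cong refl)
    fix i assume "i \<in> {..m + n}"
    show "coeff p i * coeff q (m + n - i) = (if i = m then coeff p m * coeff q n else 0)"
    proof (cases i m rule: linorder_cases)
      case less
      hence "coeff q (m + n - i) = 0" using assms by (intro coeff_eq_0) linarith
      thus ?thesis using less by simp
    next
      case greater
      hence "coeff p i = 0" using assms by (intro coeff_eq_0) linarith
      thus ?thesis using greater by simp
    qed simp
  qed
  finally show ?thesis by simp
qed

text \<open>
  The condition on the degrees says that \<open>N i / D i\<close> is homogeneous of negative degree, and \<open>nocommon'\<close>
  that on the line at infinity, too, one of the denominators is always nonzero.
  The regular function \<open>u\<close> obtained by gluing can be taken of degree less than that of \<open>g\<close> in \<open>z\<close>.  If it is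
  nonzero, comparing leading forms in \<open>D i u - N i = g e\<close> shows that the leading form of \<open>g\<close> divides those of
  all the products \<open>D i u\<close>, the numerators being too small to interfere.  By the absence of common zeros it divides
  the leading form of \<open>u\<close>, whose degree in \<open>z\<close> is too small.
\<close>

theorem no_sections_of_negative_degree:
  fixes g :: "'k::{alg_closed_field, field_gcd} poly poly"
    and D N :: "'i \<Rightarrow> 'k poly poly" and \<delta> :: "'i \<Rightarrow> nat"
  assumes I: "finite I" and lc: "is_unit (lead_coeff g)"
    and tot: "degree (dilate g) \<le> degree g"
    and nocommon: "\<And>s z. poly (poly g [:z:]) s = 0 \<Longrightarrow> \<exists>i\<in>I. poly (poly (D i) [:z:]) s \<noteq> 0"
    and cross: "\<And>i j. i \<in> I \<Longrightarrow> j \<in> I \<Longrightarrow> g dvd D i * N j - D j * N i"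
    and degD: "\<And>i. i \<in> I \<Longrightarrow> degree (dilate (D i)) \<le> \<delta> i"
    and degN: "\<And>i. i \<in> I \<Longrightarrow> degree (dilate (N i)) < \<delta> i"
    and nocommon': "\<And>w. poly (coeff (dilate g) (degree g)) w = 0 \<Longrightarrow>
                      \<exists>i\<in>I. poly (coeff (dilate (D i)) (\<delta> i)) w \<noteq> 0"
    and i: "i \<in> I"
  shows "g dvd N i"
proof -
  from glue_fractions[OF I lc nocommon cross]
  obtain u where u: "u = 0 \<or> degree u < degree g" "\<And>i. i \<in> I \<Longrightarrow> g dvd D i * u - N i"
    by blast
  define d where "d = degree g"
  define gh where "gh = coeff (dilate g) d"
  have g0: "g \<noteq> 0" using lc by auto
  have gh_d: "coeff gh d \<noteq> 0"
  proof
    assume "coeff gh d = 0"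
    hence "coeff (lead_coeff g) 0 = 0" by (simp add: gh_def coeff_dilate d_def)
    with lc show False by (auto simp: is_unit_poly_iff)
  qed
  have deg_gh: "degree gh = d"
    using gh_d degree_coeff_dilate[of g d] by (intro antisym le_degree) (auto simp: gh_def)
  have gh0: "gh \<noteq> 0" using gh_d by auto
  have "u = 0"
  proof (rule ccontr)
    assume u0: "u \<noteq> 0"
    define U where "U = dilate u"
    define E where "E = degree U"
    have U0: "U \<noteq> 0" using u0 by (simp add: U_def dilate_eq_0_iff)
    have dvd: "gh dvd coeff (dilate (D i)) (\<delta> i) * lead_coeff U" if i: "i \<in> I" for i
    proof -
      from u(2)[OF i] obtain e where e: "D i * u - N i = g * e" by (rule dvdE)
      have eq: "dilate (D i) * U - dilate (N i) = dilate g * dilate e"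
        using arg_cong[OF e, of dilate] by (simp only: U_def dilate_diff dilate_mult)
      have "coeff (dilate (D i) * U - dilate (N i)) (\<delta> i + E) = coeff (dilate (D i)) (\<delta> i) * lead_coeff U"
        using degD[OF i] degN[OF i] coeff_eq_0[of "dilate (N i)" "\<delta> i + E"]
        by (simp add: coeff_mult_top E_def)
      hence *: "coeff (dilate g * dilate e) (\<delta> i + E) = coeff (dilate (D i)) (\<delta> i) * lead_coeff U"
        unfolding eq .
      have "gh dvd coeff (dilate g * dilate e) (\<delta> i + E)"
      proof (cases "e = 0")
        case False
        hence ne: "dilate e \<noteq> 0" "dilate g \<noteq> 0" using g0 by (simp_all add: dilate_eq_0_iff)
        have dg: "degree (dilate g) = d"
          using tot gh0 by (intro antisym le_degree) (simp_all add: d_def gh_def)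
        have "degree (dilate (D i) * U - dilate (N i)) \<le> \<delta> i + E"
          using degD[OF i] degN[OF i] degree_mult_le[of "dilate (D i)" U]
          by (intro degree_diff_le) (simp_all add: E_def)
        hence "d + degree (dilate e) \<le> \<delta> i + E"
          unfolding eq by (simp add: degree_mult_eq ne dg)
        then obtain m where m: "\<delta> i + E = d + m" "degree (dilate e) \<le> m"
          by (intro that[of "\<delta> i + E - d"]) linarith+
        have "coeff (dilate g * dilate e) (d + m) = gh * coeff (dilate e) m"
          using coeff_mult_top[of "dilate g" d "dilate e" m] dg m by (simp add: gh_def)
        thus ?thesis by (simp add: m)
      qed simp
      thus ?thesis by (simp only: *)
    qed
    obtain e e' where ee: "e' * gh + (\<Sum>i\<in>I. e i * coeff (dilate (D i)) (\<delta> i)) = 1"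
      using bezout_of_no_common_root[OF I gh0, of "\<lambda>i. coeff (dilate (D i)) (\<delta> i)"] nocommon'
      by (auto simp: gh_def d_def)
    have "gh dvd (\<Sum>i\<in>I. e i * (coeff (dilate (D i)) (\<delta> i) * lead_coeff U)) + gh * (e' * lead_coeff U)"
      using dvd by (intro dvd_add[OF dvd_sum[OF dvd_mult] dvd_triv_left])
    also have "\<dots> = (e' * gh + (\<Sum>i\<in>I. e i * coeff (dilate (D i)) (\<delta> i))) * lead_coeff U"
      by (simp add: algebra_simps sum_distrib_left)
    finally have "gh dvd lead_coeff U" by (simp add: ee)
    hence "degree gh \<le> degree (lead_coeff U)" using U0 by (intro dvd_imp_degree_le) auto
    hence "d \<le> degree (lead_coeff U)" by (simp add: deg_gh)
    also have "\<dots> \<le> degree u" using degree_coeff_dilate[of u E] by (simp add: U_def E_def)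
    finally show False using u(1) u0 by (simp add: d_def)
  qed
  with u(2)[OF i] show ?thesis by simp
qed


section \<open>Evaluating and differentiating multivariate polynomials\<close>

definition monom_val :: "(nat \<Rightarrow> 'r::comm_semiring_1) \<Rightarrow> (nat \<Rightarrow>\<^sub>0 nat) \<Rightarrow> 'r" where
  "monom_val x m = (\<Prod>i\<in>Poly_Mapping.keys m. x i ^ Poly_Mapping.lookup m i)"

text \<open>
  Evaluation at a point with coordinates in a ring that contains the coefficients via \<open>\<iota>\<close>.  Besides \<open>K\<close>
  itself, this will be \<open>K[t]\<close> (restriction to lines) and \<open>K[s][z]\<close> (affine charts).
\<close>

definition eval_in :: "('k::comm_semiring_1 \<Rightarrow> 'r::comm_semiring_1) \<Rightarrow> (nat \<Rightarrow> 'r) \<Rightarrow> 'k mpoly \<Rightarrow> 'r" where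
  "eval_in \<iota> x P = (\<Sum>m\<in>Poly_Mapping.keys P. \<iota> (Poly_Mapping.lookup P m) * monom_val x m)"

lemma eval_poly_eq_eval_in: "eval_poly x P = eval_in (\<lambda>c. c) x P"
  by (simp add: eval_poly_def eval_in_def monom_val_def)

lemma monom_val_superset:
  assumes "finite W" "Poly_Mapping.keys m \<subseteq> W"
  shows "monom_val x m = (\<Prod>i\<in>W. x i ^ Poly_Mapping.lookup m i)"
  unfolding monom_val_def using assms
  by (intro prod.mono_neutral_left) (auto simp: in_keys_iff)

lemma monom_val_add: "monom_val x (m + m') = monom_val x m * monom_val x m'"
proof -
  define W where "W = Poly_Mapping.keys m \<union> Poly_Mapping.keys m'"
  have "finite W" by (simp add: W_def)
  moreover have "Poly_Mapping.keys (m + m') \<subseteq> W" "Poly_Mapping.keys m \<subseteq> W" "Poly_Mapping.keys m' \<subseteq> W"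
    using keys_add[of m m'] by (auto simp: W_def)
  ultimately show ?thesis
    by (simp add: monom_val_superset[of W] lookup_add power_add prod.distrib)
qed

lemma eval_in_0 [simp]: "eval_in \<iota> x 0 = 0"
  by (simp add: eval_in_def)

lemma eval_in_single: "\<iota> 0 = 0 \<Longrightarrow> eval_in \<iota> x (Poly_Mapping.single m c) = \<iota> c * monom_val x m"
  by (simp add: eval_in_def)

lemma eval_in_add:
  assumes "\<iota> 0 = 0" "\<And>a b. \<iota> (a + b) = \<iota> a + \<iota> b"
  shows "eval_in \<iota> x (P + Q) = eval_in \<iota> x P + eval_in \<iota> x Q"
  unfolding eval_in_def
  by (rule setsum_keys_plus_distrib) (simp_all add: assms distrib_right)

lemma eval_in_sum:
  assumes "\<iota> 0 = 0" "\<And>a b. \<iota> (a + b) = \<iota> a + \<iota> b"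
  shows "eval_in \<iota> x (sum F A) = (\<Sum>a\<in>A. eval_in \<iota> x (F a))"
  by (induction A rule: infinite_finite_induct) (simp_all add: eval_in_add assms)

lemma eval_in_hom:
  assumes "h 0 = 0" "h 1 = 1" "\<And>a b. h (a + b) = h a + h b" "\<And>a b. h (a * b) = h a * h b"
  shows "h (eval_in \<iota> x P) = eval_in (\<lambda>c. h (\<iota> c)) (\<lambda>i. h (x i)) P"
proof -
  have sum: "h (sum f A) = (\<Sum>a\<in>A. h (f a))" for f :: "(nat \<Rightarrow>\<^sub>0 nat) \<Rightarrow> _" and A
    by (induction A rule: infinite_finite_induct) (simp_all add: assms)
  have prod: "h (prod f A) = (\<Prod>a\<in>A. h (f a))" for f :: "nat \<Rightarrow> _" and A
    by (induction A rule: infinite_finite_induct) (simp_all add: assms)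
  have pow: "h (y ^ n) = h y ^ n" for y n
    by (induction n) (simp_all add: assms)
  show ?thesis by (simp add: eval_in_def monom_val_def sum prod pow assms)
qed

lemma eval_in_cong:
  assumes "\<And>i. i \<in> poly_vars P \<Longrightarrow> x i = y i"
  shows "eval_in \<iota> x P = eval_in \<iota> y P"
  unfolding eval_in_def monom_val_def 
  by (intro sum.cong refl arg_cong2[of _ _ _ _ "(*)"] prod.cong arg_cong2[of _ _ _ _ "(^)"] assms)
    (auto simp: poly_vars_def)

lemma partial_deriv_0 [simp]: "partial_deriv i 0 = 0"
  by (simp add: partial_deriv_def)

lemma keys_partial_deriv:
  assumes "m' \<in> Poly_Mapping.keys (partial_deriv i P)"
  obtains m where "m \<in> Poly_Mapping.keys P" "Poly_Mapping.lookup m i > 0"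
    "m' = m - Poly_Mapping.single i 1"
proof -
  have "Poly_Mapping.lookup (partial_deriv i P) m' \<noteq> 0" using assms by (simp add: in_keys_iff)
  then obtain m where m: "m \<in> Poly_Mapping.keys P"
    "Poly_Mapping.lookup (Poly_Mapping.single (m - Poly_Mapping.single i 1)
          (of_nat (Poly_Mapping.lookup m i) * Poly_Mapping.lookup P m)) m' \<noteq> 0"
    unfolding partial_deriv_def lookup_sum by (meson sum.not_neutral_contains_not_neutral)
  show ?thesis
  proof (rule that[of m])
    show "0 < Poly_Mapping.lookup m i" using m(2) by (cases "Poly_Mapping.lookup m i = 0") auto
    show "m' = m - Poly_Mapping.single i 1" using m(2) by (auto simp: lookup_single when_def split: if_splits)
  qed (fact m(1))
qed

lemma keys_minus_subset:
  "Poly_Mapping.keys (m - Poly_Mapping.single i 1) \<subseteq> Poly_Mapping.keys (m :: nat \<Rightarrow>\<^sub>0 nat)"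
  by (auto simp: in_keys_iff lookup_minus)

lemma poly_vars_partial_deriv: "poly_vars (partial_deriv i P) \<subseteq> poly_vars P"
proof
  fix j assume "j \<in> poly_vars (partial_deriv i P)"
  then obtain m' where "m' \<in> Poly_Mapping.keys (partial_deriv i P)" "j \<in> Poly_Mapping.keys m'"
    by (auto simp: poly_vars_def)
  thus "j \<in> poly_vars P"
    by (elim keys_partial_deriv) (use keys_minus_subset in \<open>auto simp: poly_vars_def\<close>)
qed

lemma add_single_of_pos:
  fixes m :: "nat \<Rightarrow>\<^sub>0 nat"
  assumes "Poly_Mapping.lookup m i > 0"
  shows "(m - Poly_Mapping.single i 1) + Poly_Mapping.single i 1 = m"
  by (rule poly_mapping_eqI) (use assms in \<open>auto simp: lookup_add lookup_minus lookup_single when_def\<close>)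

lemma monom_degree_superset:
  assumes "finite W" "Poly_Mapping.keys m \<subseteq> W"
  shows "monom_degree m = (\<Sum>i\<in>W. Poly_Mapping.lookup m i)"
  unfolding monom_degree_def using assms
  by (intro sum.mono_neutral_left) (auto simp: in_keys_iff)

lemma monom_degree_add: "monom_degree (m + m') = monom_degree m + monom_degree m'"
proof -
  define W where "W = Poly_Mapping.keys m \<union> Poly_Mapping.keys m'"
  have "finite W" by (simp add: W_def)
  moreover have "Poly_Mapping.keys (m + m') \<subseteq> W" "Poly_Mapping.keys m \<subseteq> W" "Poly_Mapping.keys m' \<subseteq> W"
    using keys_add[of m m'] by (auto simp: W_def)
  ultimately show ?thesis
    by (simp add: monom_degree_superset[of W] lookup_add sum.distrib)
qed

lemma monom_degree_single [simp]: "monom_degree (Poly_Mapping.single i k) = k"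
  by (simp add: monom_degree_def)

lemma homogeneous_partial_deriv:
  assumes "homogeneous_poly d P"
  shows "homogeneous_poly (d - 1) (partial_deriv i P)"
  unfolding homogeneous_poly_def
proof
  fix m' assume "m' \<in> Poly_Mapping.keys (partial_deriv i P)"
  then obtain m where m: "m \<in> Poly_Mapping.keys P" "Poly_Mapping.lookup m i > 0"
    "m' = m - Poly_Mapping.single i 1" by (rule keys_partial_deriv)
  have "d = monom_degree (m' + Poly_Mapping.single i 1)"
    using assms m add_single_of_pos[OF m(2)] by (simp add: homogeneous_poly_def)
  thus "monom_degree m' = d - 1" by (simp add: monom_degree_add)
qed

lemma eval_in_partial_deriv:
  assumes "\<iota> 0 = 0" "\<And>a b. \<iota> (a + b) = \<iota> a + \<iota> b"
  shows "eval_in \<iota> x (partial_deriv i P) = (\<Sum>m\<in>Poly_Mapping.keys P.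
            \<iota> (of_nat (Poly_Mapping.lookup m i) * Poly_Mapping.lookup P m)
              * monom_val x (m - Poly_Mapping.single i 1))"
  unfolding partial_deriv_def by (simp add: eval_in_sum eval_in_single assms)

lemma monom_val_single: "monom_val x (Poly_Mapping.single i k) = x i ^ k"
  by (simp add: monom_val_def)

lemma euler_identity:
  assumes hom: "\<iota> 0 = 0" "\<And>a b. \<iota> (a + b) = \<iota> a + \<iota> b" "\<And>a b. \<iota> (a * b) = \<iota> a * \<iota> b"
      "\<iota> 1 = 1"
    and W: "finite W" "poly_vars P \<subseteq> W" and P: "homogeneous_poly d P"
  shows "(\<Sum>i\<in>W. x i * eval_in \<iota> x (partial_deriv i P)) = of_nat d * eval_in \<iota> x P"
proof -
  have ofn: "\<iota> (of_nat n) = of_nat n" for n by (induction n) (simp_all add: hom)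
  have *: "x i * (\<iota> (of_nat (Poly_Mapping.lookup m i) * c) * monom_val x (m - Poly_Mapping.single i 1))
      = of_nat (Poly_Mapping.lookup m i) * (\<iota> c * monom_val x m)" for i m c
  proof (cases "Poly_Mapping.lookup m i = 0")
    case False
    hence "monom_val x m = monom_val x (m - Poly_Mapping.single i 1) * x i"
      using monom_val_add[of x "m - Poly_Mapping.single i 1" "Poly_Mapping.single i 1"]
      by (simp only: add_single_of_pos monom_val_single neq0_conv power_one_right)
    thus ?thesis by (simp add: hom ofn mult_ac)
  qed (simp add: hom)
  have "(\<Sum>i\<in>W. x i * eval_in \<iota> x (partial_deriv i P)) = (\<Sum>m\<in>Poly_Mapping.keys P.
      \<Sum>i\<in>W. of_nat (Poly_Mapping.lookup m i) * (\<iota> (Poly_Mapping.lookup P m) * monom_val x m))"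
    unfolding eval_in_partial_deriv[of \<iota>, OF hom(1,2)] sum_distrib_left * by (rule sum.swap)
  also have "\<dots> = (\<Sum>m\<in>Poly_Mapping.keys P. of_nat d * (\<iota> (Poly_Mapping.lookup P m) * monom_val x m))"
  proof (rule sum.cong[OF refl])
    fix m assume m: "m \<in> Poly_Mapping.keys P"
    have "Poly_Mapping.keys m \<subseteq> W" using m W(2) by (auto simp: poly_vars_def)
    hence "(\<Sum>i\<in>W. Poly_Mapping.lookup m i) = d"
      using P m monom_degree_superset[OF W(1), of m] by (simp add: homogeneous_poly_def)
    thus "(\<Sum>i\<in>W. of_nat (Poly_Mapping.lookup m i) * (\<iota> (Poly_Mapping.lookup P m) * monom_val x m))
        = of_nat d * (\<iota> (Poly_Mapping.lookup P m) * monom_val x m)"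
      by (simp flip: sum_distrib_right of_nat_sum)
  qed
  finally show ?thesis by (simp add: eval_in_def sum_distrib_left)
qed

lemma monom_val_scale: "monom_val (\<lambda>i. c * x i) m = c ^ monom_degree m * monom_val x m"
  by (simp add: monom_val_def monom_degree_def power_mult_distrib prod.distrib power_sum)

lemma eval_poly_scale:
  assumes "homogeneous_poly d P"
  shows "eval_poly (\<lambda>i. c * x i) P = c ^ d * eval_poly x P"
  unfolding eval_poly_eq_eval_in eval_in_def sum_distrib_left
  using assms by (intro sum.cong) (auto simp: monom_val_scale homogeneous_poly_def mult_ac)

lemma chain_rule_line:
  fixes P :: "'k::field mpoly"
  assumes W: "finite W" "poly_vars P \<subseteq> W"
  shows "pderiv (eval_in (\<lambda>c. [:c:]) (\<lambda>i. [:y i, v i:]) P)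
       = (\<Sum>i\<in>W. [:v i:] * eval_in (\<lambda>c. [:c:]) (\<lambda>i. [:y i, v i:]) (partial_deriv i P))"
proof -
  let ?x = "\<lambda>i. [:y i, v i:]"
  have mon: "pderiv (monom_val ?x m) = (\<Sum>i\<in>W. [:v i:] * (of_nat (Poly_Mapping.lookup m i)
      * monom_val ?x (m - Poly_Mapping.single i 1)))" if m: "Poly_Mapping.keys m \<subseteq> W" for m
  proof -
    have "pderiv (monom_val ?x m) = (\<Sum>i\<in>W. (\<Prod>j\<in>W - {i}. ?x j ^ Poly_Mapping.lookup m j)
        * pderiv (?x i ^ Poly_Mapping.lookup m i))"
      by (simp only: monom_val_superset[OF W(1) m] pderiv_prod)
    also have "\<dots> = (\<Sum>i\<in>W. [:v i:] * (of_nat (Poly_Mapping.lookup m i)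
      * monom_val ?x (m - Poly_Mapping.single i 1)))"
    proof (rule sum.cong[OF refl])
      fix i assume i: "i \<in> W"
      define k where "k = Poly_Mapping.lookup m i"
      have "monom_val ?x (m - Poly_Mapping.single i 1)
          = (\<Prod>j\<in>W. ?x j ^ Poly_Mapping.lookup (m - Poly_Mapping.single i 1) j)"
        using m keys_minus_subset[of m i] W(1) by (intro monom_val_superset) auto
      also have "\<dots> = ?x i ^ (k - 1) * (\<Prod>j\<in>W - {i}. ?x j ^ Poly_Mapping.lookup m j)"
        using i W(1) by (subst prod.remove[of W i])
          (auto simp: lookup_minus lookup_single k_def when_def intro!: prod.cong)
      finally have eq: "monom_val ?x (m - Poly_Mapping.single i 1)
          = ?x i ^ (k - 1) * (\<Prod>j\<in>W - {i}. ?x j ^ Poly_Mapping.lookup m j)" .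
      have "pderiv (?x i ^ k) = [:v i:] * (of_nat k * ?x i ^ (k - 1))"
      proof (cases k)
        case (Suc l)
        show ?thesis unfolding Suc pderiv_power_Suc
          by (simp add: pderiv_pCons of_nat_poly mult.commute)
      qed simp
      thus "(\<Prod>j\<in>W - {i}. ?x j ^ Poly_Mapping.lookup m j) * pderiv (?x i ^ Poly_Mapping.lookup m i)
          = [:v i:] * (of_nat (Poly_Mapping.lookup m i) * monom_val ?x (m - Poly_Mapping.single i 1))"
        unfolding eq k_def[symmetric] by (simp only: mult_ac)
    qed
    finally show ?thesis .
  qed
  have "pderiv (eval_in (\<lambda>c. [:c:]) ?x P)
      = (\<Sum>m\<in>Poly_Mapping.keys P. [:Poly_Mapping.lookup P m:] * pderiv (monom_val ?x m))"
    unfolding eval_in_def higher_pderiv_sum[of 1, simplified]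
    by (intro sum.cong) (simp_all add: pderiv_mult pderiv_pCons pderiv_smult)
  also have "\<dots> = (\<Sum>m\<in>Poly_Mapping.keys P. [:Poly_Mapping.lookup P m:] * (\<Sum>i\<in>W. [:v i:]
      * (of_nat (Poly_Mapping.lookup m i) * monom_val ?x (m - Poly_Mapping.single i 1))))"
    using W(2) by (intro sum.cong refl arg_cong2[of _ _ _ _ "(*)"] mon) (auto simp: poly_vars_def)
  also have "\<dots> = (\<Sum>m\<in>Poly_Mapping.keys P. \<Sum>i\<in>W. [:v i:] * ([:of_nat (Poly_Mapping.lookup m i)
      * Poly_Mapping.lookup P m:] * monom_val ?x (m - Poly_Mapping.single i 1)))"
    unfolding sum_distrib_left
    by (intro sum.cong refl) (simp add: of_nat_poly mult_ac)
  also have "\<dots> = (\<Sum>i\<in>W. [:v i:] * eval_in (\<lambda>c. [:c:]) ?x (partial_deriv i P))"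
    by (subst sum.swap) (simp add: eval_in_partial_deriv sum_distrib_left)
  finally show ?thesis .
qed

lemma top_coeff_prod:
  fixes \<alpha> \<beta> :: "nat \<Rightarrow> 'r::comm_ring_1"
  assumes "finite W"
  shows "degree (\<Prod>i\<in>W. [:\<alpha> i, \<beta> i:] ^ k i) \<le> (\<Sum>i\<in>W. k i)"
    and "coeff (\<Prod>i\<in>W. [:\<alpha> i, \<beta> i:] ^ k i) (\<Sum>i\<in>W. k i) = (\<Prod>i\<in>W. \<beta> i ^ k i)"
proof -
  have pow: "degree ([:a, b:] ^ n) \<le> n \<and> coeff ([:a, b:] ^ n) n = b ^ n" for a b :: 'r and n
  proof (induction n)
    case (Suc n)
    have d1: "degree [:a, b:] \<le> 1" by simp
    have "degree ([:a, b:] * [:a, b:] ^ n) \<le> Suc n"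
      using degree_mult_le[of "[:a, b:]" "[:a, b:] ^ n"] d1 Suc by linarith
    moreover have "coeff ([:a, b:] * [:a, b:] ^ n) (1 + n) = b * b ^ n"
      using coeff_mult_top[OF d1, of "[:a, b:] ^ n" n] Suc by simp
    ultimately show ?case by simp
  qed simp
  have "degree (\<Prod>i\<in>W. [:\<alpha> i, \<beta> i:] ^ k i) \<le> (\<Sum>i\<in>W. k i) \<and>
    coeff (\<Prod>i\<in>W. [:\<alpha> i, \<beta> i:] ^ k i) (\<Sum>i\<in>W. k i) = (\<Prod>i\<in>W. \<beta> i ^ k i)"
    using assms
  proof (induction W rule: finite_induct)
    case (insert j W)
    let ?Q = "\<Prod>i\<in>W. [:\<alpha> i, \<beta> i:] ^ k i"
    have "degree ([:\<alpha> j, \<beta> j:] ^ k j * ?Q) \<le> k j + (\<Sum>i\<in>W. k i)"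
      using degree_mult_le[of "[:\<alpha> j, \<beta> j:] ^ k j" ?Q] pow[of "\<alpha> j" "\<beta> j" "k j"] insert.IH by linarith
    moreover have "coeff ([:\<alpha> j, \<beta> j:] ^ k j * ?Q) (k j + (\<Sum>i\<in>W. k i)) = \<beta> j ^ k j * (\<Prod>i\<in>W. \<beta> i ^ k i)"
      using pow[of "\<alpha> j" "\<beta> j" "k j"] insert.IH by (subst coeff_mult_top) auto
    ultimately show ?case using insert.hyps by simp
  qed simp
  thus "degree (\<Prod>i\<in>W. [:\<alpha> i, \<beta> i:] ^ k i) \<le> (\<Sum>i\<in>W. k i)"
    and "coeff (\<Prod>i\<in>W. [:\<alpha> i, \<beta> i:] ^ k i) (\<Sum>i\<in>W. k i) = (\<Prod>i\<in>W. \<beta> i ^ k i)" by auto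
qed

text \<open>
  Along \<open>\<alpha> + t \<beta>\<close> the top coefficient in \<open>t\<close> of a form is its value at the point \<open>\<beta>\<close> at infinity.
\<close>

lemma top_coeff_eval_in:
  fixes \<alpha> \<beta> :: "nat \<Rightarrow> 'r::comm_ring_1"
  assumes P: "homogeneous_poly d P"
  shows "degree (eval_in (\<lambda>c. [:\<kappa> c:]) (\<lambda>i. [:\<alpha> i, \<beta> i:]) P) \<le> d"
    and "coeff (eval_in (\<lambda>c. [:\<kappa> c:]) (\<lambda>i. [:\<alpha> i, \<beta> i:]) P) d = eval_in \<kappa> \<beta> P"
proof -
  have mon: "degree (monom_val (\<lambda>i. [:\<alpha> i, \<beta> i:]) m) \<le> d \<and>
      coeff (monom_val (\<lambda>i. [:\<alpha> i, \<beta> i:]) m) d = monom_val \<beta> m" if "m \<in> Poly_Mapping.keys P" for m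
  proof -
    have "d = (\<Sum>i\<in>Poly_Mapping.keys m. Poly_Mapping.lookup m i)"
      using P that by (simp add: homogeneous_poly_def monom_degree_def)
    thus ?thesis unfolding monom_val_def by (simp add: top_coeff_prod)
  qed
  show "degree (eval_in (\<lambda>c. [:\<kappa> c:]) (\<lambda>i. [:\<alpha> i, \<beta> i:]) P) \<le> d"
    unfolding eval_in_def using mon
    by (intro degree_sum_le) (auto intro: order.trans[OF degree_smult_le])
  show "coeff (eval_in (\<lambda>c. [:\<kappa> c:]) (\<lambda>i. [:\<alpha> i, \<beta> i:]) P) d = eval_in \<kappa> \<beta> P"
    unfolding eval_in_def coeff_sum using mon by (intro sum.cong) auto
qed

lemma digits_unique:
  fixes f f' :: "nat \<Rightarrow> nat"
  assumes "\<And>i. f i < B" "\<And>i. f' i < B" "(\<Sum>i<n. f i * B ^ i) = (\<Sum>i<n. f' i * B ^ i)" "i < n"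
  shows "f i = f' i"
  using assms(3,4)
proof (induction n)
  case (Suc n)
  have small: "(\<Sum>i<n. h i * B ^ i) < B ^ n" if hB: "\<And>i. h i < B" for h :: "nat \<Rightarrow> nat" and n
  proof (induction n)
    case (Suc n)
    have "(\<Sum>i<Suc n. h i * B ^ i) < B ^ n + h n * B ^ n" using Suc by simp
    also have "\<dots> = Suc (h n) * B ^ n" by simp
    also have "\<dots> \<le> B * B ^ n" using hB[of n] by (intro mult_right_mono) auto
    finally show ?case by simp
  qed simp
  have B: "B > 0" using assms(1)[of 0] by simp
  have eq: "(\<Sum>i<n. f i * B ^ i) + f n * B ^ n = (\<Sum>i<n. f' i * B ^ i) + f' n * B ^ n"
    using Suc.prems(1) by simp
  have "f n = f' n"
    using arg_cong[OF eq, of "\<lambda>k. k div B ^ n"] small[of f n, OF assms(1)] small[of f' n, OF assms(2)] B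
    by simp
  with eq Suc.IH Suc.prems(2) show ?case by (cases "i = n") auto
qed simp

text \<open>
  Kronecker's substitution \<open>X\<^sub>i \<mapsto> t\<close> to the power \<open>B\<^sup>i\<close>: if \<open>B\<close> exceeds all exponents, distinct monomials
  become distinct powers of \<open>t\<close>, by uniqueness of the digits in base \<open>B\<close>.
\<close>

lemma mpoly_nonzero_point:
  fixes P :: "'k::field mpoly"
  assumes inf: "infinite (UNIV :: 'k set)" and P: "P \<noteq> 0"
  shows "\<exists>x. eval_poly x P \<noteq> 0"
proof -
  have fin: "finite (poly_vars P)" by (simp add: poly_vars_def)
  then obtain n where n: "poly_vars P \<subseteq> {..<n}" using finite_nat_bounded by blast
  define S where "S = (\<Union>m\<in>Poly_Mapping.keys P. Poly_Mapping.range m)"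
  have "finite (insert 0 S)" by (simp add: S_def)
  then obtain B where B: "insert 0 S \<subseteq> {..<B}" using finite_nat_bounded by blast
  have lt: "Poly_Mapping.lookup m i < B" if "m \<in> Poly_Mapping.keys P" for m i
  proof (cases "i \<in> Poly_Mapping.keys m")
    case True
    hence "Poly_Mapping.lookup m i \<in> S" using that by (auto simp: S_def intro: in_keys_lookup_in_range)
    thus ?thesis using B by auto
  qed (use B in \<open>auto simp: in_keys_iff\<close>)
  define f where "f m = (\<Sum>i<n. Poly_Mapping.lookup m i * B ^ i)" for m
  have keys: "Poly_Mapping.keys m \<subseteq> {..<n}" if "m \<in> Poly_Mapping.keys P" for m
    using n that by (auto simp: poly_vars_def)
  have inj: "m = m'" if mm: "m \<in> Poly_Mapping.keys P" "m' \<in> Poly_Mapping.keys P" "f m = f m'" for m m'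
  proof (rule poly_mapping_eqI)
    fix i
    show "Poly_Mapping.lookup m i = Poly_Mapping.lookup m' i"
    proof (cases "i < n")
      case True
      thus ?thesis using digits_unique[of "Poly_Mapping.lookup m" B "Poly_Mapping.lookup m'" n i]
        lt mm by (simp add: f_def)
    next
      case False
      hence "i \<notin> Poly_Mapping.keys m" "i \<notin> Poly_Mapping.keys m'" using keys mm by auto
      thus ?thesis by (simp add: in_keys_iff)
    qed
  qed
  define Q where "Q = eval_in (\<lambda>c. [:c:]) (\<lambda>i. monom 1 (B ^ i)) P"
  have mon: "monom_val (\<lambda>i. monom (1::'k) (B ^ i)) m = monom 1 (f m)" if "m \<in> Poly_Mapping.keys P" for m
  proof -
    have "(\<Prod>i<k. monom (1::'k) (B ^ i) ^ Poly_Mapping.lookup m i)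
        = monom 1 (\<Sum>i<k. Poly_Mapping.lookup m i * B ^ i)" for k
      by (induction k) (simp_all add: monom_power mult_monom monom_0 one_pCons mult.commute add.commute)
    moreover have "monom_val (\<lambda>i. monom (1::'k) (B ^ i)) m
        = (\<Prod>i<n. monom 1 (B ^ i) ^ Poly_Mapping.lookup m i)"
      using keys[OF that] by (intro monom_val_superset) auto
    ultimately show ?thesis by (simp add: f_def)
  qed
  from P obtain m0 where m0: "m0 \<in> Poly_Mapping.keys P" by fastforce
  have "coeff Q (f m0) = (\<Sum>m\<in>Poly_Mapping.keys P. if m = m0 then Poly_Mapping.lookup P m else 0)"
    unfolding Q_def eval_in_def coeff_sum
    using m0 inj by (intro sum.cong refl) (auto simp: mon)
  also have "\<dots> \<noteq> 0" using m0 by (simp add: in_keys_iff)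
  finally have "Q \<noteq> 0" by auto
  then obtain t where t: "poly Q t \<noteq> 0"
    using poly_roots_finite[of Q] inf by fastforce
  have "poly Q t = eval_poly (\<lambda>i. t ^ (B ^ i)) P"
    unfolding Q_def eval_poly_eq_eval_in by (subst eval_in_hom) (simp_all add: poly_monom)
  thus ?thesis using t by metis
qed


section \<open>Affine charts of the projective plane\<close>

lemma lookup_partial_deriv:
  "Poly_Mapping.lookup (partial_deriv i P) m
    = of_nat (Suc (Poly_Mapping.lookup m i)) * Poly_Mapping.lookup P (m + Poly_Mapping.single i 1)"
proof -
  let ?m = "m + Poly_Mapping.single i 1"
  have "Poly_Mapping.lookup (partial_deriv i P) m = (\<Sum>m'\<in>Poly_Mapping.keys P.
      (of_nat (Poly_Mapping.lookup m' i) * Poly_Mapping.lookup P m' when m' - Poly_Mapping.single i 1 = m))"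
    by (simp add: partial_deriv_def lookup_sum lookup_single)
  also have "\<dots> = (\<Sum>m'\<in>Poly_Mapping.keys P.
      if m' = ?m then of_nat (Poly_Mapping.lookup ?m i) * Poly_Mapping.lookup P ?m else 0)"
  proof (rule sum.cong[OF refl])
    fix m' :: "nat \<Rightarrow>\<^sub>0 nat"
    show "(of_nat (Poly_Mapping.lookup m' i) * Poly_Mapping.lookup P m' when m' - Poly_Mapping.single i 1 = m)
      = (if m' = ?m then of_nat (Poly_Mapping.lookup ?m i) * Poly_Mapping.lookup P ?m else 0)"
    proof (cases "Poly_Mapping.lookup m' i = 0")
      case True
      hence "m' \<noteq> ?m" by (auto simp: lookup_add)
      thus ?thesis using True by (simp add: when_def)
    next
      case False
      hence "m' - Poly_Mapping.single i 1 = m \<longleftrightarrow> m' = ?m"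
        using add_single_of_pos[of m' i] by auto
      thus ?thesis by (simp only: when_def) simp
    qed
  qed
  also have "\<dots> = of_nat (Poly_Mapping.lookup ?m i) * Poly_Mapping.lookup P ?m"
    by (simp add: in_keys_iff)
  finally show ?thesis by (simp add: lookup_add)
qed

lemma partial_deriv_commute: "partial_deriv i (partial_deriv j P) = partial_deriv j (partial_deriv i P)"
  by (rule poly_mapping_eqI)
    (simp add: lookup_partial_deriv lookup_add lookup_single when_def ac_simps)

text \<open>
  The affine chart with origin \<open>a\<close> and directions \<open>b\<close>, \<open>c\<close>.  It covers the projective plane outside the line
  through \<open>b\<close> and \<open>c\<close>; the vertical lines are the lines through \<open>c\<close>.  A chart adapted to the curve is needed
  because the centre of projection \<open>c\<close> must lie off the curve, and no coordinate point need have this property.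
\<close>

definition chart_point :: "(nat \<Rightarrow> 'k) \<Rightarrow> (nat \<Rightarrow> 'k) \<Rightarrow> (nat \<Rightarrow> 'k) \<Rightarrow> 'k \<Rightarrow> 'k \<Rightarrow> nat \<Rightarrow> 'k::comm_ring_1" where
  "chart_point a b c s z = (\<lambda>i. a i + s * b i + z * c i)"

definition chart :: "(nat \<Rightarrow> 'k) \<Rightarrow> (nat \<Rightarrow> 'k) \<Rightarrow> (nat \<Rightarrow> 'k) \<Rightarrow> 'k mpoly \<Rightarrow> 'k::comm_ring_1 poly poly" where
  "chart a b c P = eval_in (\<lambda>k. [:[:k:]:]) (\<lambda>i. [:[:a i, b i:], [:c i:]:]) P"

lemma chart_along_s: "poly (chart a b c P) [:z:] = eval_in (\<lambda>k. [:k:]) (\<lambda>i. [:a i + z * c i, b i:]) P"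
  unfolding chart_def by (subst eval_in_hom) (simp_all add: mult.commute)

lemma chart_along_z: "fibre s (chart a b c P) = eval_in (\<lambda>k. [:k:]) (\<lambda>i. [:a i + s * b i, c i:]) P"
  unfolding chart_def
  by (subst eval_in_hom) (simp_all add: fibre_add fibre_mult, simp add: fibre_def map_poly_pCons mult.commute)

lemma poly_line: "poly (eval_in (\<lambda>k. [:k:]) (\<lambda>i. [:y i, v i:]) P) t = eval_poly (\<lambda>i. y i + t * v i) P"
  unfolding eval_poly_eq_eval_in by (subst eval_in_hom) (simp_all add: mult.commute)

lemma eval_chart: "poly (poly (chart a b c P) [:z:]) s = eval_poly (chart_point a b c s z) P"
  unfolding chart_along_s poly_line chart_point_def by (simp add: algebra_simps)

lemma pderiv_chart_along_s:
  fixes P :: "'k::field mpoly"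
  assumes "finite W" "poly_vars P \<subseteq> W"
  shows "poly (pderiv (poly (chart a b c P) [:z:])) s
       = (\<Sum>i\<in>W. b i * eval_poly (chart_point a b c s z) (partial_deriv i P))"
  unfolding chart_along_s chain_rule_line[OF assms] poly_sum poly_mult poly_line
  by (simp add: chart_point_def algebra_simps)

lemma pderiv_chart_along_z:
  fixes P :: "'k::field mpoly"
  assumes "finite W" "poly_vars P \<subseteq> W"
  shows "poly (pderiv (fibre s (chart a b c P))) z
       = (\<Sum>i\<in>W. c i * eval_poly (chart_point a b c s z) (partial_deriv i P))"
  unfolding chart_along_z chain_rule_line[OF assms] poly_sum poly_mult poly_line
  by (simp add: chart_point_def algebra_simps)

text \<open>
  After the dilation the coordinates are \<open>a + t (b + w c)\<close>, so the leading forms are governed by the points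
  \<open>b + w c\<close> of the line at infinity.
\<close>

lemma dilate_chart: "dilate (chart a b c P) = eval_in (\<lambda>k. [:[:k:]:]) (\<lambda>i. [:[:a i:], [:b i, c i:]:]) P"
proof -
  have 1: "dilate [:[:k:]:] = [:[:k:]:]" for k :: 'a
    by (simp add: dilate_def map_poly_pCons lift_const_def)
  have 2: "dilate [:[:x, y:], [:z:]:] = [:[:x:], [:y, z:]:]" for x y z :: 'a
    by (simp add: dilate_def map_poly_pCons lift_const_def)
  have 3: "dilate (1 :: 'a poly poly) = 1" using 1[of 1] by (simp add: one_pCons)
  show ?thesis unfolding chart_def
    by (subst eval_in_hom[of dilate]) (simp_all add: dilate_add dilate_mult 1 2 3)
qed

lemma degree_dilate_chart:
  assumes "homogeneous_poly d P"
  shows "degree (dilate (chart a b c P)) \<le> d"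
    and "poly (coeff (dilate (chart a b c P)) d) w = eval_poly (\<lambda>i. b i + w * c i) P"
  unfolding dilate_chart using assms by (simp_all add: top_coeff_eval_in poly_line)

lemma degree_chart:
  assumes "homogeneous_poly d P"
  shows "degree (chart a b c P) \<le> d" "coeff (chart a b c P) d = [:eval_poly c P:]"
proof -
  show "degree (chart a b c P) \<le> d" unfolding chart_def using assms by (rule top_coeff_eval_in)
  have "coeff (chart a b c P) d = eval_in (\<lambda>k. [:k:]) (\<lambda>i. [:c i:]) P"
    unfolding chart_def using assms by (rule top_coeff_eval_in)
  also have "\<dots> = [:eval_poly c P:]"
    unfolding eval_poly_eq_eval_in by (rule eval_in_hom[symmetric]) (simp_all add: one_pCons)
  finally show "coeff (chart a b c P) d = [:eval_poly c P:]" .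
qed

text \<open>
  For vectors in the coordinates \<open>0, 1, 2\<close>: \<open>a\<close>, \<open>b\<close>, \<open>c\<close> form a basis of \<open>K\<^sup>3\<close>.  Independence and spanning are both
  included to avoid dimension theory.
\<close>

definition frame :: "(nat \<Rightarrow> 'k) \<Rightarrow> (nat \<Rightarrow> 'k) \<Rightarrow> (nat \<Rightarrow> 'k::field) \<Rightarrow> bool" where
  "frame a b c \<longleftrightarrow>
     (\<forall>\<alpha> \<beta> \<gamma>. (\<forall>i\<in>{0,1,2}. \<alpha> * a i + \<beta> * b i + \<gamma> * c i = 0) \<longrightarrow> \<alpha> = 0 \<and> \<beta> = 0 \<and> \<gamma> = 0) \<and>
     (\<forall>v. \<exists>\<alpha> \<beta> \<gamma>. \<forall>i\<in>{0,1,2}. v i = \<alpha> * a i + \<beta> * b i + \<gamma> * c i)"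

lemma frame_indep:
  assumes "frame a b c" "\<And>i. i \<in> {0,1,2} \<Longrightarrow> \<alpha> * a i + \<beta> * b i + \<gamma> * c i = 0"
  shows "\<alpha> = 0" "\<beta> = 0" "\<gamma> = 0"
proof -
  from assms(1) have "(\<forall>i\<in>{0,1,2}. \<alpha> * a i + \<beta> * b i + \<gamma> * c i = 0) \<longrightarrow> \<alpha> = 0 \<and> \<beta> = 0 \<and> \<gamma> = 0"
    unfolding frame_def by (elim conjE allE)
  with assms(2) show "\<alpha> = 0" "\<beta> = 0" "\<gamma> = 0" by auto
qed

lemma frame_spans:
  assumes "frame a b c"
  obtains \<alpha> \<beta> \<gamma> where "\<And>i. i \<in> {0,1,2} \<Longrightarrow> v i = \<alpha> * a i + \<beta> * b i + \<gamma> * c i"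
proof -
  from assms have "\<exists>\<alpha> \<beta> \<gamma>. \<forall>i\<in>{0,1,2}. v i = \<alpha> * a i + \<beta> * b i + \<gamma> * c i"
    unfolding frame_def by (elim conjE allE)
  with that show ?thesis by (elim exE) auto
qed

lemma frame_orthogonal:
  assumes fr: "frame a b c" and o: "(\<Sum>i\<in>{0,1,2}. a i * n i) = 0" "(\<Sum>i\<in>{0,1,2}. b i * n i) = 0"
    "(\<Sum>i\<in>{0,1,2}. c i * n i) = 0" and i: "i \<in> {0,1,2}"
  shows "n i = 0"
proof -
  define v where "v j = (if j = i then 1 else 0 :: 'a)" for j
  obtain \<alpha> \<beta> \<gamma> where v: "\<And>j. j \<in> {0,1,2} \<Longrightarrow> v j = \<alpha> * a j + \<beta> * b j + \<gamma> * c j"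
    using frame_spans[OF fr] by blast
  have "n i = (\<Sum>j\<in>{0,1,2}. v j * n j)" using i by (auto simp: v_def)
  also have "\<dots> = (\<Sum>j\<in>{0,1,2}. (\<alpha> * a j + \<beta> * b j + \<gamma> * c j) * n j)"
    using v by (intro sum.cong) auto
  also have "\<dots> = \<alpha> * (\<Sum>i\<in>{0,1,2}. a i * n i) + \<beta> * (\<Sum>i\<in>{0,1,2}. b i * n i) + \<gamma> * (\<Sum>i\<in>{0,1,2}. c i * n i)"
    by (simp only: distrib_right sum.distrib sum_distrib_left mult.assoc)
  finally show ?thesis using o by simp
qed

lemma frame_exists:
  assumes "k \<in> {0,1,2}" "c k \<noteq> 0"
  shows "\<exists>a b. frame a b c"
proof -
  have ex: "frame (\<lambda>l. if l = i then 1 else 0) (\<lambda>l. if l = j then 1 else 0) c"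
    if ij: "{0, 1, 2} = {i, j, k}" "i \<noteq> j" "i \<noteq> k" "j \<noteq> k" for i j
    unfolding frame_def ij(1)
  proof (intro conjI allI impI)
    fix \<alpha> \<beta> \<gamma> assume *: "\<forall>l\<in>{i,j,k}. \<alpha> * (if l = i then 1 else 0) + \<beta> * (if l = j then 1 else 0) + \<gamma> * c l = 0"
    show "\<gamma> = 0" using * ij(2-4) assms(2) by auto
    with * ij(2-4) show "\<alpha> = 0" "\<beta> = 0" by auto
  next
    fix v :: "nat \<Rightarrow> 'a"
    show "\<exists>\<alpha> \<beta> \<gamma>. \<forall>l\<in>{i,j,k}. v l = \<alpha> * (if l = i then 1 else 0) + \<beta> * (if l = j then 1 else 0) + \<gamma> * c l"
      by (intro exI[of _ "v i - v k / c k * c i"] exI[of _ "v j - v k / c k * c j"] exI[of _ "v k / c k"])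
        (use ij(2-4) assms(2) in auto)
  qed
  from assms(1) consider "k = 0" | "k = 1" | "k = 2" by auto
  thus ?thesis
  proof cases
    case 1 thus ?thesis using ex[of 1 2] by auto
  next
    case 2 thus ?thesis using ex[of 0 2] by auto
  next
    case 3 thus ?thesis using ex[of 0 1] by auto
  qed
qed

lemma frame_point_nonzero: "frame a b c \<Longrightarrow> \<exists>i\<in>{0,1,2}. chart_point a b c s z i \<noteq> 0"
  using frame_indep(1)[of a b c 1 s z] by (auto simp: chart_point_def)

lemma frame_point_at_infinity_nonzero: "frame a b c \<Longrightarrow> \<exists>i\<in>{0,1,2}. b i + w * c i \<noteq> 0"
  using frame_indep(2)[of a b c 0 1 w] by auto

text \<open>
  If the form \<open>P\<close> vanishes on the chart, then by homogeneity it vanishes wherever the \<open>a\<close>-coordinate is nonzero.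
  Along a line in direction \<open>a\<close> only one point is excluded, and \<open>P\<close> vanishes there as well.
\<close>

lemma chart_inj:
  fixes P :: "'k::field mpoly"
  assumes inf: "infinite (UNIV :: 'k set)" and fr: "frame a b c" and P: "homogeneous_poly d P"
    and vars: "poly_vars P \<subseteq> {0,1,2}" and chart: "chart a b c P = 0"
  shows "P = 0"
proof (rule ccontr)
  assume "P \<noteq> 0"
  then obtain x where x: "eval_poly x P \<noteq> 0" using mpoly_nonzero_point inf by blast
  define Q where "Q = eval_in (\<lambda>k. [:k:]) (\<lambda>i. [:x i, a i:]) P"
  have "poly Q 0 \<noteq> 0" using x by (simp add: Q_def poly_line)
  hence "Q \<noteq> 0" by auto
  obtain \<alpha> \<beta> \<gamma> where v: "\<And>j. j \<in> {0,1,2} \<Longrightarrow> x j = \<alpha> * a j + \<beta> * b j + \<gamma> * c j"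
    using frame_spans[OF fr] by blast
  have "poly Q t = 0" if t: "\<alpha> + t \<noteq> 0" for t
  proof -
    have "poly Q t = eval_poly (\<lambda>i. x i + t * a i) P" by (simp add: Q_def poly_line)
    also have "\<dots> = eval_poly (\<lambda>i. (\<alpha> + t) * chart_point a b c (\<beta> / (\<alpha> + t)) (\<gamma> / (\<alpha> + t)) i) P"
      unfolding eval_poly_eq_eval_in
    proof (rule eval_in_cong)
      fix i assume "i \<in> poly_vars P"
      hence "x i = \<alpha> * a i + \<beta> * b i + \<gamma> * c i" using vars v by blast
      thus "x i + t * a i = (\<alpha> + t) * chart_point a b c (\<beta> / (\<alpha> + t)) (\<gamma> / (\<alpha> + t)) i"
        using t by (simp add: chart_point_def distrib_left) (simp add: distrib_right)
    qed
    also have "\<dots> = (\<alpha> + t) ^ d * eval_poly (chart_point a b c (\<beta> / (\<alpha> + t)) (\<gamma> / (\<alpha> + t))) P"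
      by (rule eval_poly_scale[OF P])
    also have "\<dots> = 0" by (simp flip: eval_chart add: chart)
    finally show ?thesis .
  qed
  hence "UNIV - {-\<alpha>} \<subseteq> {t. poly Q t = 0}" by (auto simp: add_eq_0_iff)
  moreover have "infinite (UNIV - {-\<alpha>})" using inf by simp
  ultimately show False using poly_roots_finite[OF \<open>Q \<noteq> 0\<close>] finite_subset by blast
qed


section \<open>The Hessian form on the tangent plane\<close>

text \<open>
  For \<open>i\<close>, \<open>j\<close> fixed, \<open>n\<^sub>j e\<^sub>i - n\<^sub>i e\<^sub>j\<close> is orthogonal to \<open>n\<close>, and such vectors span the orthogonal complement of \<open>n\<close>.
  The hypothesis says that \<open>M\<close> maps this complement into the line of \<open>n\<close>; in particular the form \<open>M\<close> is zero on
  it.  The vector \<open>u\<close> is found from the row of \<open>M\<close> belonging to an index with \<open>n i0 \<noteq> 0\<close>.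
\<close>

lemma symmetric_product_of_isotropic:
  fixes n :: "nat \<Rightarrow> 'k::field" and M :: "nat \<Rightarrow> nat \<Rightarrow> 'k"
  assumes two: "(2::'k) \<noteq> 0"
    and sym: "\<And>i j. M i j = M j i"
    and i0: "i0 \<in> W" "n i0 \<noteq> 0"
    and iso: "\<And>i j. i \<in> W \<Longrightarrow> j \<in> W \<Longrightarrow> \<exists>l. \<forall>k\<in>W. M k i * n j - M k j * n i = l * n k"
  shows "\<exists>u. \<forall>i\<in>W. \<forall>j\<in>W. M i j = n i * u j + u i * n j"
proof (intro exI ballI)
  define u where "u j = (M i0 j - n j * M i0 i0 / (2 * n i0)) / n i0" for j
  fix j k assume jk: "j \<in> W" "k \<in> W"
  from iso[OF jk(2) i0(1)] obtain l where l: "\<And>m. m \<in> W \<Longrightarrow> M m k * n i0 - M m i0 * n k = l * n m"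
    by blast
  have l0: "l * n i0 = M i0 k * n i0 - M i0 i0 * n k" using l[OF i0(1)] by simp
  have "(M j k * n i0 - M j i0 * n k) * n i0 = (M i0 k * n i0 - M i0 i0 * n k) * n j"
    using l[OF jk(1)] l0 by (simp add: mult.commute mult.left_commute)
  hence "M j k * (n i0 * n i0) = M i0 j * n k * n i0 + M i0 k * n j * n i0 - M i0 i0 * n k * n j"
    by (simp add: algebra_simps sym[of j i0])
  also have "\<dots> = (n j * u k + u j * n k) * (n i0 * n i0)"
    using i0(2) two by (simp add: u_def divide_simps) (simp add: algebra_simps)
  finally show "M j k = n j * u k + u j * n k"
    using i0(2) by simp
qed

text \<open>
  Two independent vectors \<open>x\<close>, \<open>y\<close> orthogonal to \<open>n\<close> span its complement.  Explicitly, \<open>n\<close> is a multiple \<open>\<kappa>\<close> of the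
  cross product \<open>m\<close> of \<open>x\<close> and \<open>y\<close>, and the vectors \<open>m\<^sub>j e\<^sub>i - m\<^sub>i e\<^sub>j\<close> are of the form \<open>x\<^sub>h y - y\<^sub>h x\<close>.
\<close>

lemma hessian_symmetric_product:
  fixes n x y :: "nat \<Rightarrow> 'k::field" and M :: "nat \<Rightarrow> nat \<Rightarrow> 'k"
  assumes two: "(2::'k) \<noteq> 0"
    and sym: "\<And>i j. M i j = M j i"
    and n0: "\<exists>i\<in>{0,1,2}. n i \<noteq> 0"
    and nx: "(\<Sum>i\<in>{0,1,2}. x i * n i) = 0" and ny: "(\<Sum>i\<in>{0,1,2}. y i * n i) = 0"
    and Mx: "\<And>j. j \<in> {0,1,2} \<Longrightarrow> (\<Sum>i\<in>{0,1,2}. x i * M j i) = \<mu> * n j"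
    and My: "\<And>j. j \<in> {0,1,2} \<Longrightarrow> (\<Sum>i\<in>{0,1,2}. y i * M j i) = \<eta> * n j"
    and indep: "\<exists>i\<in>{0,1,2}. \<exists>j\<in>{0,1,2}. x i * y j \<noteq> x j * y i"
  shows "\<exists>u. \<forall>i\<in>{0,1,2}. \<forall>j\<in>{0,1,2}. M i j = n i * u j + u i * n j"
proof -
  define m where "m = (\<lambda>k::nat. if k = 0 then x 1 * y 2 - x 2 * y 1
      else if k = 1 then x 2 * y 0 - x 0 * y 2 else x 0 * y 1 - x 1 * y 0)"
  have m: "m 0 = x 1 * y 2 - x 2 * y 1" "m 1 = x 2 * y 0 - x 0 * y 2" "m 2 = x 0 * y 1 - x 1 * y 0"
    by (simp_all add: m_def)
  have nx': "x 0 * n 0 + x 1 * n 1 + x 2 * n 2 = 0" and ny': "y 0 * n 0 + y 1 * n 1 + y 2 * n 2 = 0"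
    using nx ny by (simp_all add: add.assoc)
  have par01: "n 0 * m 1 = n 1 * m 0"
  proof -
    have "n 0 * m 1 - n 1 * m 0
        = x 2 * (y 0 * n 0 + y 1 * n 1 + y 2 * n 2) - y 2 * (x 0 * n 0 + x 1 * n 1 + x 2 * n 2)"
      unfolding m by (simp add: algebra_simps)
    thus ?thesis using nx' ny' by simp
  qed
  have par12: "n 1 * m 2 = n 2 * m 1"
  proof -
    have "n 1 * m 2 - n 2 * m 1
        = x 0 * (y 0 * n 0 + y 1 * n 1 + y 2 * n 2) - y 0 * (x 0 * n 0 + x 1 * n 1 + x 2 * n 2)"
      unfolding m by (simp add: algebra_simps)
    thus ?thesis using nx' ny' by simp
  qed
  have par20: "n 2 * m 0 = n 0 * m 2"
  proof -
    have "n 2 * m 0 - n 0 * m 2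
        = x 1 * (y 0 * n 0 + y 1 * n 1 + y 2 * n 2) - y 1 * (x 0 * n 0 + x 1 * n 1 + x 2 * n 2)"
      unfolding m by (simp add: algebra_simps)
    thus ?thesis using nx' ny' by simp
  qed
  have par: "n i * m j = n j * m i" if "i \<in> {0,1,2}" "j \<in> {0,1,2}" for i j
    using that par01 par12 par20 by auto
  have "\<exists>j\<in>{0,1,2}. m j \<noteq> 0"
  proof (rule ccontr)
    assume "\<not> (\<exists>j\<in>{0,1,2}. m j \<noteq> 0)"
    hence "m 0 = 0" "m 1 = 0" "m 2 = 0" by auto
    thus False using indep unfolding m by (auto simp: mult.commute)
  qed
  then obtain j0 where j0: "j0 \<in> {0,1,2}" "m j0 \<noteq> 0" by blast
  define \<kappa> where "\<kappa> = n j0 / m j0"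
  have nm: "n i = \<kappa> * m i" if "i \<in> {0,1,2}" for i
    using par[OF that j0(1)] j0(2) by (simp add: \<kappa>_def field_simps)
  have Mx': "x 0 * M k 0 + x 1 * M k 1 + x 2 * M k 2 = \<mu> * n k"
    and My': "y 0 * M k 0 + y 1 * M k 1 + y 2 * M k 2 = \<eta> * n k" if "k \<in> {0,1,2}" for k
    using Mx[OF that] My[OF that] by (simp_all add: add.assoc)
  have step: "\<exists>l. \<forall>k\<in>{0,1,2}. M k i * n j - M k j * n i = l * n k"
    if ij: "i \<in> {0,1,2}" "j \<in> {0,1,2}"
      and eq: "\<And>k. M k i * m j - M k j * m i
        = x h * (y 0 * M k 0 + y 1 * M k 1 + y 2 * M k 2) - y h * (x 0 * M k 0 + x 1 * M k 1 + x 2 * M k 2)"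
    for i j h
  proof (intro exI ballI)
    fix k :: nat assume k: "k \<in> {0,1,2}"
    have "M k i * n j - M k j * n i = \<kappa> * (M k i * m j - M k j * m i)"
      using nm ij by (simp add: algebra_simps)
    also have "\<dots> = \<kappa> * (x h * \<eta> - y h * \<mu>) * n k"
      unfolding eq Mx'[OF k] My'[OF k] by (simp add: algebra_simps)
    finally show "M k i * n j - M k j * n i = \<kappa> * (x h * \<eta> - y h * \<mu>) * n k" .
  qed
  have s01: "\<exists>l. \<forall>k\<in>{0,1,2}. M k 0 * n 1 - M k 1 * n 0 = l * n k"
    by (rule step[where h = 2]) (simp_all only: m, auto simp: algebra_simps)
  have s12: "\<exists>l. \<forall>k\<in>{0,1,2}. M k 1 * n 2 - M k 2 * n 1 = l * n k"
    by (rule step[where h = 0]) (simp_all only: m, auto simp: algebra_simps)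
  have s20: "\<exists>l. \<forall>k\<in>{0,1,2}. M k 2 * n 0 - M k 0 * n 2 = l * n k"
    by (rule step[where h = 1]) (simp_all only: m, auto simp: algebra_simps)
  have swap: "\<exists>l. \<forall>k\<in>{0,1,2}. M k j * n i - M k i * n j = l * n k"
    if ex: "\<exists>l. \<forall>k\<in>{0,1,2}. M k i * n j - M k j * n i = l * n k" for i j
  proof -
    from ex obtain l where l: "\<forall>k\<in>{0,1,2}. M k i * n j - M k j * n i = l * n k" by blast
    have "\<forall>k\<in>{0,1,2}. M k j * n i - M k i * n j = - l * n k"
    proof
      fix k :: nat assume "k \<in> {0,1,2}"
      hence "M k i * n j - M k j * n i = l * n k" using l by blast
      thus "M k j * n i - M k i * n j = - l * n k" by (simp add: algebra_simps)
    qed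
    thus ?thesis by blast
  qed
  have diag: "\<exists>l. \<forall>k\<in>{0,1,2}. M k i * n i - M k i * n i = l * n k" for i
    by (rule exI[of _ 0]) simp
  obtain i0 where i0: "i0 \<in> {0,1,2}" "n i0 \<noteq> 0" using n0 by blast
  define Q where "Q i j \<longleftrightarrow> (\<exists>l. \<forall>k\<in>{0,1,2}. M k i * n j - M k j * n i = l * n k)" for i j
  have "Q 0 1" "Q 1 2" "Q 2 0" "Q 0 0" "Q 1 1" "Q 2 2"
    unfolding Q_def by (fact s01 s12 s20 diag)+
  moreover have "Q 1 0" "Q 2 1" "Q 0 2"
    unfolding Q_def by (rule swap[OF s01], rule swap[OF s12], rule swap[OF s20])
  ultimately have Q: "Q i j" if "i \<in> {0,1,2}" "j \<in> {0,1,2}" for i j using that by auto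
  show ?thesis
    by (rule symmetric_product_of_isotropic[of M i0 _ n, OF two sym i0 Q[unfolded Q_def]])
qed

text \<open>
  A point \<open>x\<close> proportional to \<open>x\<^sup>q\<close> has, after scaling, all coordinates among the finitely many roots of
  \<open>T\<^sup>q = T\<close>, and each such vector \<open>r\<close> is proportional to at most one point of the chart.
\<close>

lemma finite_frobenius_fixed_slopes:
  fixes a b c :: "nat \<Rightarrow> 'k::field"
  assumes fr: "frame a b c" and q: "q > 1"
  shows "finite {s. \<exists>z. \<forall>i\<in>{0,1,2}. \<forall>j\<in>{0,1,2}.
            chart_point a b c s z i * chart_point a b c s z j ^ q = chart_point a b c s z j * chart_point a b c s z i ^ q}" (is "finite ?E")
proof -
  define Z where "Z = {t::'k. t ^ q = t}"
  have "finite Z"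
  proof -
    have "coeff (monom 1 q - monom (1::'k) 1) q = 1" using q by simp
    hence "monom 1 q - monom (1::'k) 1 \<noteq> 0" by (metis coeff_0 zero_neq_one)
    hence "finite {t. poly (monom 1 q - monom (1::'k) 1) t = 0}" by (rule poly_roots_finite)
    thus ?thesis by (simp add: Z_def poly_monom)
  qed
  define R where "R = PiE {0,1,2::nat} (\<lambda>_. Z)"
  have "finite R" unfolding R_def using \<open>finite Z\<close> by (intro finite_PiE) auto
  define S where "S r = {s. \<exists>z \<mu>. \<forall>i\<in>{0,1,2::nat}. chart_point a b c s z i = \<mu> * r i}" for r
  have single: "s = s'" if ss: "s \<in> S r" "s' \<in> S r" for r s s'
  proof -
    obtain z \<mu> where 1: "\<And>i. i \<in> {0,1,2} \<Longrightarrow> chart_point a b c s z i = \<mu> * r i" using ss(1) by (auto simp: S_def)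
    obtain z' \<mu>' where 2: "\<And>i. i \<in> {0,1,2} \<Longrightarrow> chart_point a b c s' z' i = \<mu>' * r i" using ss(2) by (auto simp: S_def)
    have lin: "(\<mu>' - \<mu>) * a i + (\<mu>' * s - \<mu> * s') * b i + (\<mu>' * z - \<mu> * z') * c i = 0"
      if "i \<in> {0,1,2}" for i
    proof -
      have "(\<mu>' - \<mu>) * a i + (\<mu>' * s - \<mu> * s') * b i + (\<mu>' * z - \<mu> * z') * c i
          = \<mu>' * chart_point a b c s z i - \<mu> * chart_point a b c s' z' i"
        by (simp add: chart_point_def algebra_simps)
      also have "\<dots> = 0" using 1[OF that] 2[OF that] by simp
      finally show ?thesis .
    qed
    have "\<mu>' = \<mu>" "\<mu>' * s = \<mu> * s'" using frame_indep[OF fr lin] by simp_all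
    moreover have "\<mu> \<noteq> 0" using frame_point_nonzero[OF fr, of s z] 1 by auto
    ultimately show ?thesis by simp
  qed
  have finS: "finite (S r)" for r
  proof (cases "S r = {}")
    case False
    then obtain s where "s \<in> S r" by blast
    hence "S r \<subseteq> {s}" using single by blast
    thus ?thesis using finite_subset by blast
  qed simp
  have "?E \<subseteq> (\<Union>r\<in>R. S r)"
  proof
    fix s assume "s \<in> ?E"
    then obtain z where z: "\<And>i j. i \<in> {0,1,2} \<Longrightarrow> j \<in> {0,1,2} \<Longrightarrow>
        chart_point a b c s z i * chart_point a b c s z j ^ q = chart_point a b c s z j * chart_point a b c s z i ^ q" by blast
    define x where "x = chart_point a b c s z"
    obtain k where k: "k \<in> {0,1,2}" "x k \<noteq> 0" using frame_point_nonzero[OF fr, of s z] by (auto simp: x_def)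
    define r where "r = restrict (\<lambda>i. x i / x k) {0,1,2}"
    have "r i \<in> Z" if i: "i \<in> {0,1,2}" for i
    proof -
      have "x k * x i ^ q = x i * x k ^ q" using z[OF k(1) i] by (simp add: x_def)
      hence "(x i / x k) ^ q = x i / x k" using k(2) by (simp add: field_simps)
      thus ?thesis using i by (simp add: r_def Z_def)
    qed
    hence "r \<in> R" by (auto simp: R_def r_def)
    moreover have "s \<in> S r"
      unfolding S_def
      by (rule CollectI, rule exI[of _ z], rule exI[of _ "x k"]) (use k(2) in \<open>auto simp: r_def x_def\<close>)
    ultimately show "s \<in> (\<Union>r\<in>R. S r)" by blast
  qed
  thus ?thesis using \<open>finite R\<close> finS finite_subset by (metis (no_types, lifting) finite_UN_I)
qed


section \<open>Smooth Frobenius nonclassical plane curves\<close>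

lemma degree_dilate_mult:
  assumes "degree (dilate f) \<le> m" "degree (dilate h) \<le> n"
  shows "degree (dilate (f * h)) \<le> m + n"
  using degree_mult_le[of "dilate f" "dilate h"] assms by (simp add: dilate_mult)

text \<open>
  The gradient is \<open>D\<close>, the Hessian \<open>H\<close>, and \<open>g\<close> is the equation of the curve in a chart whose centre of
  projection \<open>c\<close> is off the curve, which makes \<open>g\<close> monic in \<open>z\<close> up to a constant.
\<close>

theorem smooth_frobenius_nonclassical_curve_hessian:
  fixes G :: "'k::{alg_closed_field, field_gcd} mpoly"
  assumes hom: "homogeneous_poly d G" and vars: "poly_vars G \<subseteq> {0,1,2}" and d: "d \<ge> 2"
    and dk: "of_nat d \<noteq> (0::'k)" and two: "(2::'k) \<noteq> 0"
    and q: "q > 1" and qk: "of_nat q = (0::'k)"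
    and smooth: "\<And>x. eval_poly x G = 0 \<Longrightarrow> \<exists>i\<in>{0,1,2}. x i \<noteq> 0 \<Longrightarrow>
                   \<exists>i\<in>{0,1,2}. eval_poly x (partial_deriv i G) \<noteq> 0"
    and frob: "\<And>x. eval_poly x G = 0 \<Longrightarrow> \<exists>i\<in>{0,1,2}. x i \<noteq> 0 \<Longrightarrow>
                   (\<Sum>i\<in>{0,1,2}. eval_poly x (partial_deriv i G) * x i ^ q) = 0"
    and jk: "j \<in> {0,1,2}" "k \<in> {0,1,2}"
  shows "partial_deriv j (partial_deriv k G) = 0"
proof -
  let ?W = "{0,1,2::nat}"
  have inf: "infinite (UNIV :: 'k set)" by (rule infinite_alg_closed)
  have W: "finite ?W" by simp
  define D where "D i = partial_deriv i G" for i
  define H where "H i j = partial_deriv i (D j)" for i j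
  have Hsym: "H i j = H j i" for i j by (simp add: H_def D_def partial_deriv_commute)
  have varsD: "poly_vars (D i) \<subseteq> ?W" for i
    using poly_vars_partial_deriv[of i G] vars by (auto simp: D_def)
  have varsH: "poly_vars (H i j) \<subseteq> ?W" for i j
    using poly_vars_partial_deriv[of i "D j"] varsD[of j] by (auto simp: H_def)
  have homD: "homogeneous_poly (d - 1) (D i)" for i
    unfolding D_def by (rule homogeneous_partial_deriv[OF hom])
  have homH: "homogeneous_poly (d - 1 - 1) (H i j)" for i j
    unfolding H_def by (rule homogeneous_partial_deriv[OF homD])
  have eulerG: "(\<Sum>i\<in>?W. x i * eval_poly x (D i)) = of_nat d * eval_poly x G" for x
    unfolding eval_poly_eq_eval_in D_def by (rule euler_identity[OF _ _ _ _ W vars hom]) simp_all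
  have eulerD: "(\<Sum>i\<in>?W. x i * eval_poly x (H i j)) = of_nat (d - 1) * eval_poly x (D j)" for x j
    unfolding eval_poly_eq_eval_in H_def by (rule euler_identity[OF _ _ _ _ W varsD homD]) simp_all

  have "\<exists>c. eval_poly c G \<noteq> 0"
  proof (rule ccontr)
    assume "\<not> (\<exists>c. eval_poly c G \<noteq> 0)"
    hence "G = 0" using mpoly_nonzero_point[OF inf, of G] by blast
    thus False using smooth[of "\<lambda>_. 1"] by (auto simp: eval_poly_eq_eval_in)
  qed
  then obtain c where c: "eval_poly c G \<noteq> 0" by blast
  have "\<exists>i\<in>?W. c i \<noteq> 0"
  proof (rule ccontr)
    assume "\<not> (\<exists>i\<in>?W. c i \<noteq> 0)"
    hence "eval_poly c G = eval_poly (\<lambda>i. 0 * c i) G"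
      unfolding eval_poly_eq_eval_in using vars by (intro eval_in_cong) auto
    also have "\<dots> = 0 ^ d * eval_poly c G" by (rule eval_poly_scale[OF hom])
    finally show False using c d by (simp add: power_0_left)
  qed
  then obtain a b where fr: "frame a b c" using frame_exists by blast
  let ?\<phi> = "chart a b c" and ?x = "chart_point a b c"
  define g where "g = ?\<phi> G"
  have lcg: "degree g = d" "is_unit (lead_coeff g)"
  proof -
    have "coeff g d \<noteq> 0" using c by (simp add: g_def degree_chart[OF hom])
    thus deg: "degree g = d"
      using degree_chart(1)[OF hom, of a b c] by (intro antisym le_degree) (simp_all add: g_def)
    show "is_unit (lead_coeff g)"
      using c unfolding deg unfolding g_def degree_chart(2)[OF hom]
      by (simp add: is_unit_const_poly_iff dvd_field_iff)
  qed
  have evg: "poly (poly g [:z:]) s = eval_poly (?x s z) G" for s z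
    by (simp add: g_def eval_chart)
  have smooth_chart_point: "\<exists>i\<in>?W. eval_poly (?x s z) (D i) \<noteq> 0" if "poly (poly g [:z:]) s = 0" for s z
    unfolding D_def using that evg frame_point_nonzero[OF fr] by (intro smooth) auto
  have orth: "n i = 0"
    if "(\<Sum>i\<in>?W. b i * n i) = 0" "(\<Sum>i\<in>?W. c i * n i) = 0" "(\<Sum>i\<in>?W. ?x s z i * n i) = 0"
      "i \<in> ?W" for n s z i
  proof (rule frame_orthogonal[OF fr _ that(1,2,4)])
    have "(\<Sum>i\<in>?W. ?x s z i * n i)
        = (\<Sum>i\<in>?W. a i * n i) + s * (\<Sum>i\<in>?W. b i * n i) + z * (\<Sum>i\<in>?W. c i * n i)"
      by (simp only: chart_point_def distrib_right sum.distrib sum_distrib_left mult.assoc)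
    thus "(\<Sum>i\<in>?W. a i * n i) = 0" using that by simp
  qed

  \<comment> \<open>At a zero of a multiple factor the derivatives along \<open>b\<close> and \<open>c\<close> vanish, and by Euler's identity so does
    the one along the point itself; the curve would be singular there.\<close>
  have sqf: "is_unit f" if f: "f ^ 2 dvd g" for f
  proof (rule ccontr)
    assume nu: "\<not> is_unit f"
    from f obtain h where h: "g = f ^ 2 * h" by (rule dvdE)
    have "f dvd g" unfolding h by (simp add: power2_eq_square)
    hence lcf: "is_unit (lead_coeff f)" using lcg(2) by (rule unit_lead_coeff_dvd)
    have "degree f \<noteq> 0"
    proof
      assume "degree f = 0"
      then obtain r where "f = [:r:]" by (rule degree_eq_zeroE)
      thus False using lcf nu by (simp add: is_unit_const_poly_iff)
    qed
    hence "degree (fibre 0 f) > 0" using degree_fibre[OF lcf] by simp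
    then obtain z where z: "poly (fibre 0 f) z = 0" using alg_closed_imp_poly_has_root by blast
    have z': "poly (poly f [:z:]) 0 = 0" using z by (simp add: poly_fibre)
    have g0: "poly (poly g [:z:]) 0 = 0" by (simp add: h z' poly_mult poly_power)
    have "poly (pderiv (poly g [:z:])) 0 = 0"
      unfolding h by (simp add: poly_mult pderiv_mult power2_eq_square z')
    hence b0: "(\<Sum>i\<in>?W. b i * eval_poly (?x 0 z) (D i)) = 0"
      unfolding g_def D_def pderiv_chart_along_s[OF W vars] .
    have "poly (pderiv (fibre 0 g)) z = 0"
      unfolding h by (simp add: fibre_mult pderiv_mult power2_eq_square z)
    hence c0: "(\<Sum>i\<in>?W. c i * eval_poly (?x 0 z) (D i)) = 0"
      unfolding g_def D_def pderiv_chart_along_z[OF W vars] .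
    have "(\<Sum>i\<in>?W. ?x 0 z i * eval_poly (?x 0 z) (D i)) = 0"
      using g0 by (simp only: eulerG evg) simp
    from orth[OF b0 c0 this] smooth_chart_point[OF g0] show False by blast
  qed

  \<comment> \<open>The vertical lines that contain a point proportional to its Frobenius image.\<close>
  define E where "E = {s. \<exists>z. \<forall>i\<in>?W. \<forall>j\<in>?W. ?x s z i * ?x s z j ^ q = ?x s z j * ?x s z i ^ q}"
  have finE: "finite E" unfolding E_def by (rule finite_frobenius_fixed_slopes[OF fr q])
  have null: "g dvd h"
    if "\<And>s z. s \<notin> E \<Longrightarrow> poly (poly g [:z:]) s = 0 \<Longrightarrow> poly (poly h [:z:]) s = 0" for h
    by (rule plane_nullstellensatz[OF lcg(2) sqf finE that])

  define L where "L i = [:[:a i, b i:], [:c i:]:]" for i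
  have L1: "poly (L i) [:z:] = [:a i + z * c i, b i:]" for i z by (simp add: L_def mult.commute)
  have L2: "fibre s (L i) = [:a i + s * b i, c i:]" for i s
    by (simp add: L_def fibre_def map_poly_pCons mult.commute)
  have L3: "poly [:a i + z * c i, b i:] s = ?x s z i" "poly [:a i + s * b i, c i:] z = ?x s z i" for i s z
    by (simp_all add: chart_point_def algebra_simps)
  \<comment> \<open>\<open>T\<close> is \<open>\<Sum> G\<^sub>i X\<^sub>i\<^sup>q\<close> in the chart, with \<open>L i\<close> the coordinate \<open>X\<^sub>i\<close>.\<close>
  define T where "T = (\<Sum>i\<in>?W. ?\<phi> (D i) * L i ^ q)"
  have fibre_pow: "fibre s (f ^ n) = fibre s f ^ n" for s :: 'k and f n
    by (induction n) (simp_all add: fibre_mult)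
  have "g dvd T"
  proof (rule null)
    fix s z assume g0: "poly (poly g [:z:]) s = 0"
    have "poly (poly T [:z:]) s = (\<Sum>i\<in>?W. eval_poly (?x s z) (D i) * ?x s z i ^ q)"
      unfolding T_def by (simp only: poly_sum poly_mult poly_power L1 L3 eval_chart)
    also have "\<dots> = 0"
      unfolding D_def using g0 evg frame_point_nonzero[OF fr] by (intro frob) auto
    finally show "poly (poly T [:z:]) s = 0" .
  qed
  then obtain \<eta> where \<eta>: "T = g * \<eta>" by (rule dvdE)
  have pderiv_pow: "pderiv (f ^ q) = 0" for f :: "'k poly"
    using q qk by (cases q) (simp_all add: pderiv_power_Suc del: power_Suc)

  have u_exists: "\<exists>u. \<forall>i\<in>?W. \<forall>j\<in>?W. eval_poly (?x s z) (H i j)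
      = eval_poly (?x s z) (D i) * u j + u i * eval_poly (?x s z) (D j)"
    if s: "s \<notin> E" and g0: "poly (poly g [:z:]) s = 0" for s z
  proof -
    define x where "x = ?x s z"
    define n where "n i = eval_poly x (D i)" for i
    define M where "M i j = eval_poly x (H i j)" for i j
    define e where "e = poly (poly \<eta> [:z:]) s"
    have nx: "(\<Sum>i\<in>?W. x i * n i) = 0"
      using g0 evg eulerG[of x] by (simp add: n_def x_def)
    have "(\<Sum>i\<in>?W. eval_poly x (D i) * x i ^ q) = 0"
      unfolding D_def x_def using g0 evg frame_point_nonzero[OF fr] by (intro frob) auto
    hence ny: "(\<Sum>i\<in>?W. x i ^ q * n i) = 0"
      by (simp only: n_def mult.commute)
    \<comment> \<open>\<open>n'\<close> is the difference of the two sides of \<open>M x\<^sup>q = \<eta> n\<close>.  It is orthogonal to \<open>b\<close> and \<open>c\<close> by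
      differentiating \<open>T = g \<eta>\<close> along \<open>s\<close> and \<open>z\<close>, and to \<open>x\<close> by Euler's identity.\<close>
    define n' where "n' j = (\<Sum>i\<in>?W. x i ^ q * M j i) - e * n j" for j
    have ortho_dir: "(\<Sum>j\<in>?W. v j * n' j)
        = (\<Sum>i\<in>?W. (\<Sum>j\<in>?W. v j * M j i) * x i ^ q) - (\<Sum>j\<in>?W. v j * n j) * e" for v
    proof -
      have "(\<Sum>j\<in>?W. v j * n' j) = (\<Sum>j\<in>?W. \<Sum>i\<in>?W. v j * M j i * x i ^ q) - (\<Sum>j\<in>?W. v j * n j) * e"
        unfolding n'_def by (simp only: right_diff_distrib sum_subtractf sum_distrib_left sum_distrib_right mult_ac)
      also have "(\<Sum>j\<in>?W. \<Sum>i\<in>?W. v j * M j i * x i ^ q) = (\<Sum>i\<in>?W. (\<Sum>j\<in>?W. v j * M j i) * x i ^ q)"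
        by (subst sum.swap) (simp only: sum_distrib_right)
      finally show ?thesis .
    qed
    have b0: "(\<Sum>j\<in>?W. b j * n' j) = 0"
    proof -
      have "poly (pderiv (poly T [:z:])) s = (\<Sum>i\<in>?W. (\<Sum>j\<in>?W. b j * M j i) * x i ^ q)"
        unfolding T_def poly_sum poly_mult poly_power L1 higher_pderiv_sum[of 1, simplified]
        by (simp only: pderiv_mult pderiv_pow poly_add poly_mult poly_power L3 poly_0 poly_sum
              pderiv_chart_along_s[OF W varsD] M_def H_def x_def mult_zero_right add_0_left add_0_right)
          (simp only: mult.commute)
      moreover have "poly (pderiv (poly T [:z:])) s = (\<Sum>j\<in>?W. b j * n j) * e"
        unfolding \<eta> poly_mult pderiv_mult poly_add
        using g0 pderiv_chart_along_s[OF W vars, of a b c z s]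
        by (simp add: g_def n_def D_def x_def e_def mult.commute)
      ultimately show ?thesis unfolding ortho_dir by simp
    qed
    have c0: "(\<Sum>j\<in>?W. c j * n' j) = 0"
    proof -
      have "poly (pderiv (fibre s T)) z = (\<Sum>i\<in>?W. (\<Sum>j\<in>?W. c j * M j i) * x i ^ q)"
        unfolding T_def fibre_sum fibre_mult fibre_pow L2 higher_pderiv_sum[of 1, simplified] poly_sum
        by (simp only: pderiv_mult pderiv_pow poly_add poly_mult poly_power L3 poly_0 poly_sum
              pderiv_chart_along_z[OF W varsD] M_def H_def x_def mult_zero_right add_0_left add_0_right)
          (simp only: mult.commute)
      moreover have "poly (pderiv (fibre s T)) z = (\<Sum>j\<in>?W. c j * n j) * e"
        unfolding \<eta> fibre_mult pderiv_mult poly_add poly_mult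
        using g0 pderiv_chart_along_z[OF W vars, of s a b c z]
        by (simp add: g_def n_def D_def x_def e_def mult.commute poly_fibre)
      ultimately show ?thesis unfolding ortho_dir by simp
    qed
    have Mx: "(\<Sum>i\<in>?W. x i * M j i) = of_nat (d - 1) * n j" for j
      using eulerD[of x j] by (simp only: M_def n_def Hsym[of j])
    have x0: "(\<Sum>j\<in>?W. x j * n' j) = 0"
    proof -
      have "(\<Sum>j\<in>?W. x j * M j i) = of_nat (d - 1) * n i" for i
        using eulerD[of x i] by (simp only: M_def n_def)
      hence "(\<Sum>i\<in>?W. (\<Sum>j\<in>?W. x j * M j i) * x i ^ q) = (\<Sum>i\<in>?W. of_nat (d - 1) * (x i ^ q * n i))"
        by (simp only: mult_ac)
      also have "\<dots> = 0" by (simp only: sum_distrib_left[symmetric] ny mult_zero_right)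
      finally show ?thesis unfolding ortho_dir nx by simp
    qed
    have My: "(\<Sum>i\<in>?W. x i ^ q * M j i) = e * n j" if "j \<in> ?W" for j
      using orth[OF b0 c0 x0[unfolded x_def] that] by (simp add: n'_def)
    have "\<exists>u. \<forall>i\<in>?W. \<forall>j\<in>?W. M i j = n i * u j + u i * n j"
    proof (rule hessian_symmetric_product[OF two _ _ nx ny Mx My])
      show "M i j = M j i" for i j by (simp add: M_def Hsym)
      show "\<exists>i\<in>?W. n i \<noteq> 0" using smooth_chart_point[OF g0] by (simp add: n_def x_def)
      show "\<exists>i\<in>?W. \<exists>j\<in>?W. x i * x j ^ q \<noteq> x j * x i ^ q"
        using s unfolding E_def x_def by blast
    qed
    thus ?thesis by (simp only: M_def n_def x_def)
  qed

  \<comment> \<open>On the curve \<open>N j i = 2 D2 i u\<^sub>j\<close>, so the fractions \<open>N j i / D2 i\<close> for \<open>i = 0, 1, 2\<close> all represent the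
    function \<open>2 u\<^sub>j\<close>, of degree \<open>(2 d - 3) - (2 d - 2)\<close>.\<close>
  define N where "N j i = ?\<phi> (D i) * ?\<phi> (H i j) + ?\<phi> (D i) * ?\<phi> (H i j) - ?\<phi> (D j) * ?\<phi> (H i i)" for i j
  define D2 where "D2 i = ?\<phi> (D i) * ?\<phi> (D i)" for i
  have N_val: "poly (poly (N j i) [:z:]) s = 2 * (eval_poly (?x s z) (D i)) ^ 2 * u j"
    if u: "\<forall>i\<in>?W. \<forall>j\<in>?W. eval_poly (?x s z) (H i j)
      = eval_poly (?x s z) (D i) * u j + u i * eval_poly (?x s z) (D j)"
      and ij: "i \<in> ?W" "j \<in> ?W" for u s z i j
  proof -
    have "eval_poly (?x s z) (H i j) = eval_poly (?x s z) (D i) * u j + u i * eval_poly (?x s z) (D j)"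
      "eval_poly (?x s z) (H i i) = eval_poly (?x s z) (D i) * u i + u i * eval_poly (?x s z) (D i)"
      using u ij by blast+
    thus ?thesis unfolding N_def by (simp add: eval_chart algebra_simps power2_eq_square)
  qed
  have dvdN: "g dvd N j i" if ij: "i \<in> ?W" "j \<in> ?W" for i j
  proof (rule no_sections_of_negative_degree[where I = ?W and D = D2 and \<delta> = "\<lambda>_. 2 * d - 2"])
    show "finite ?W" by simp
    show "is_unit (lead_coeff g)" by (fact lcg(2))
    show "degree (dilate g) \<le> degree g" unfolding lcg(1) unfolding g_def by (rule degree_dilate_chart[OF hom])
    show "\<exists>i\<in>?W. poly (poly (D2 i) [:z:]) s \<noteq> 0" if "poly (poly g [:z:]) s = 0" for s z
      using smooth_chart_point[OF that] by (simp add: D2_def eval_chart)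
    show "g dvd D2 i * N j k - D2 k * N j i" if ik: "i \<in> ?W" "k \<in> ?W" for i k
    proof (rule null)
      fix s z assume s: "s \<notin> E" and g0: "poly (poly g [:z:]) s = 0"
      from u_exists[OF this] obtain u where u: "\<forall>i\<in>?W. \<forall>j\<in>?W. eval_poly (?x s z) (H i j)
          = eval_poly (?x s z) (D i) * u j + u i * eval_poly (?x s z) (D j)" by blast
      show "poly (poly (D2 i * N j k - D2 k * N j i) [:z:]) s = 0"
        using N_val[OF u ik(1) ij(2)] N_val[OF u ik(2) ij(2)]
        by (simp add: D2_def eval_chart power2_eq_square)
    qed
    show "degree (dilate (D2 i)) \<le> 2 * d - 2" for i
      using degree_dilate_mult[OF degree_dilate_chart(1)[OF homD] degree_dilate_chart(1)[OF homD], of a b c i a b c i]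
      by (simp add: D2_def)
    show "degree (dilate (N j i)) < 2 * d - 2" for i
    proof -
      have deg: "degree (dilate (?\<phi> (D i) * ?\<phi> (H k l))) \<le> 2 * d - 3" for i k l
        using degree_dilate_mult[OF degree_dilate_chart(1)[OF homD] degree_dilate_chart(1)[OF homH], of a b c i a b c k l] d
        by simp
      have "degree (dilate (N j i)) \<le> 2 * d - 3"
        unfolding N_def dilate_diff dilate_add by (intro degree_diff_le degree_add_le deg)
      thus ?thesis using d by simp
    qed
    show "\<exists>i\<in>?W. poly (coeff (dilate (D2 i)) (2 * d - 2)) w \<noteq> 0"
      if w: "poly (coeff (dilate g) (degree g)) w = 0" for w
    proof -
      have "eval_poly (\<lambda>i. b i + w * c i) G = 0"
        using w unfolding lcg(1) unfolding g_def degree_dilate_chart(2)[OF hom] .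
      hence "\<exists>i\<in>?W. eval_poly (\<lambda>i. b i + w * c i) (D i) \<noteq> 0"
        unfolding D_def using frame_point_at_infinity_nonzero[OF fr] by (intro smooth) auto
      then obtain i where i: "i \<in> ?W" "eval_poly (\<lambda>i. b i + w * c i) (D i) \<noteq> 0" by blast
      have "2 * d - 2 = (d - 1) + (d - 1)" by simp
      hence "coeff (dilate (D2 i)) (2 * d - 2) = coeff (dilate (?\<phi> (D i))) (d - 1) * coeff (dilate (?\<phi> (D i))) (d - 1)"
        using coeff_mult_top[OF degree_dilate_chart(1)[OF homD] degree_dilate_chart(1)[OF homD], of a b c i a b c i]
        by (simp only: D2_def dilate_mult)
      hence "poly (coeff (dilate (D2 i)) (2 * d - 2)) w = eval_poly (\<lambda>i. b i + w * c i) (D i) ^ 2"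
        by (simp only: poly_mult degree_dilate_chart(2)[OF homD] power2_eq_square)
      thus ?thesis using i by auto
    qed
    show "i \<in> ?W" by (fact ij(1))
  qed

  have "g dvd ?\<phi> (H j k)"
  proof (rule null)
    fix s z assume s: "s \<notin> E" and g0: "poly (poly g [:z:]) s = 0"
    from u_exists[OF this] obtain u where u: "\<forall>i\<in>?W. \<forall>j\<in>?W. eval_poly (?x s z) (H i j)
        = eval_poly (?x s z) (D i) * u j + u i * eval_poly (?x s z) (D j)" by blast
    from smooth_chart_point[OF g0] obtain i where i: "i \<in> ?W" "eval_poly (?x s z) (D i) \<noteq> 0" by blast
    have u0: "u l = 0" if l: "l \<in> ?W" for l
    proof -
      from dvdN[OF i(1) l] obtain h where "N l i = g * h" by (rule dvdE)
      hence "poly (poly (N l i) [:z:]) s = 0" using g0 by simp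
      thus ?thesis using N_val[OF u i(1) l] i(2) two by simp
    qed
    show "poly (poly (?\<phi> (H j k)) [:z:]) s = 0"
      using u[rule_format, OF jk] u0[OF jk(1)] u0[OF jk(2)] by (simp add: eval_chart)
  qed
  moreover have "degree (?\<phi> (H j k)) < degree g"
    using degree_chart(1)[OF homH, of a b c j k] d by (simp add: lcg(1))
  ultimately have "?\<phi> (H j k) = 0"
    using dvd_imp_degree_le by (metis not_less)
  thus ?thesis using chart_inj[OF inf fr homH varsH] unfolding H_def D_def by blast
qed


section \<open>Polynomials with vanishing Hessian in characteristic \<open>p\<close>\<close>

lemma sum_monomials: "(\<Sum>m\<in>Poly_Mapping.keys P. Poly_Mapping.single m (Poly_Mapping.lookup P m)) = P"
proof (rule poly_mapping_eqI)
  fix m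
  have "Poly_Mapping.lookup (\<Sum>m\<in>Poly_Mapping.keys P. Poly_Mapping.single m (Poly_Mapping.lookup P m)) m
      = (\<Sum>m'\<in>Poly_Mapping.keys P. if m' = m then Poly_Mapping.lookup P m else 0)"
    unfolding lookup_sum by (intro sum.cong) (auto simp: lookup_single when_def)
  thus "Poly_Mapping.lookup (\<Sum>m\<in>Poly_Mapping.keys P. Poly_Mapping.single m (Poly_Mapping.lookup P m)) m
      = Poly_Mapping.lookup P m" by (simp add: in_keys_iff)
qed

lemma lookup_map: "f 0 = 0 \<Longrightarrow> Poly_Mapping.lookup (Poly_Mapping.map f m) i = f (Poly_Mapping.lookup m i)"
  by (simp add: map.rep_eq when_def)

lemma single_power:
  fixes m :: "nat \<Rightarrow>\<^sub>0 nat" and c :: "'a::comm_semiring_1"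
  shows "Poly_Mapping.single m c ^ k = Poly_Mapping.single (Poly_Mapping.map ((*) k) m) (c ^ k)"
proof (induction k)
  case 0
  have "Poly_Mapping.map ((*) 0) m = 0" by (rule poly_mapping_eqI) (simp add: lookup_map)
  thus ?case by (simp only: power_0 single_one)
next
  case (Suc k)
  have "m + Poly_Mapping.map ((*) k) m = Poly_Mapping.map ((*) (Suc k)) m"
    by (rule poly_mapping_eqI) (simp add: lookup_map lookup_add)
  thus ?case by (simp add: Suc.IH mult_single del: times_nat.simps)
qed

lemma CHAR_mpoly: "CHAR('a::comm_semiring_1 mpoly) = CHAR('a)"
proof (rule CHAR_eqI)
  show "of_nat CHAR('a) = (0 :: 'a mpoly)" by (simp flip: single_of_nat)
  fix x assume "of_nat x = (0 :: 'a mpoly)"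
  hence "Poly_Mapping.lookup (of_nat x :: 'a mpoly) 0 = 0" by simp
  hence "of_nat x = (0 :: 'a)" by (simp add: lookup_of_nat)
  thus "CHAR('a) dvd x" by (simp add: of_nat_eq_0_iff_char_dvd)
qed

text \<open>
  The Frobenius map is injective, hence surjective on a finite field.
\<close>

lemma pth_root_exists:
  fixes c :: "'a::{field,finite}"
  assumes p: "prime p" "CHAR('a) = p"
  shows "\<exists>b. b ^ p = c"
proof -
  have "inj (\<lambda>x::'a. x ^ p)"
  proof (rule injI)
    fix x y :: 'a assume eq: "x ^ p = y ^ p"
    have "(x - y + y) ^ p = (x - y) ^ p + y ^ p" by (rule freshmans_dream) (use p in auto)
    hence "(x - y) ^ p = 0" using eq by simp
    thus "x = y" by simp
  qed
  hence "surj (\<lambda>x::'a. x ^ p)" by (rule finite_UNIV_inj_surj[rotated]) simp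
  thus ?thesis by (metis surjD)
qed

lemma CHAR_of_card:
  assumes "prime p" "card (UNIV :: 'a::{field,finite} set) = p ^ e"
  shows "CHAR('a) = p"
proof -
  have "(\<Sum>x\<in>UNIV. x) = (\<Sum>x\<in>(UNIV::'a set). x + 1)"
    by (rule sum.reindex_bij_witness[of _ "\<lambda>x. x + 1" "\<lambda>x. x - 1"]) auto
  hence "of_nat (card (UNIV :: 'a set)) = (0 :: 'a)" by (simp add: sum.distrib)
  hence "CHAR('a) dvd p ^ e" by (simp only: assms(2) of_nat_eq_0_iff_char_dvd)
  moreover have "prime CHAR('a)" by (intro prime_CHAR_semidom finite_imp_CHAR_pos) simp
  ultimately show ?thesis using assms(1) by (metis prime_dvd_power primes_dvd_imp_eq)
qed

text \<open>
  The coefficient of \<open>G\<^sub>i\<^sub>j\<close> that comes from the monomial \<open>X\<^sup>M\<close> is \<open>M\<^sub>i M\<^sub>j\<close>, respectively \<open>M\<^sub>i (M\<^sub>i - 1)\<close> if \<open>i = j\<close>,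
  times the coefficient of \<open>X\<^sup>M\<close> in \<open>G\<close>.  Both numbers are therefore divisible by \<open>p\<close>, while the sum \<open>d\<close> of
  the exponents is not.
\<close>

lemma exponents_of_zero_hessian:
  fixes G :: "'a::field mpoly"
  assumes p: "prime p" "CHAR('a) = p"
    and G: "homogeneous_poly d G" "poly_vars G \<subseteq> {0,1,2}" and pd: "\<not> p dvd d"
    and hess: "\<forall>i\<in>{0,1,2}. \<forall>j\<in>{0,1,2}. partial_deriv i (partial_deriv j G) = 0"
    and M: "M \<in> Poly_Mapping.keys G"
  shows "\<exists>i\<in>{0,1,2}. Poly_Mapping.lookup M i > 0 \<and> p dvd Poly_Mapping.lookup M i - 1
          \<and> (\<forall>j. j \<noteq> i \<longrightarrow> p dvd Poly_Mapping.lookup M j)"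
    and "p dvd d - 1"
proof -
  let ?W = "{0,1,2::nat}" and ?l = "Poly_Mapping.lookup M"
  have keysM: "Poly_Mapping.keys M \<subseteq> ?W" using G(2) M by (auto simp: poly_vars_def)
  have d: "d = ?l 0 + (?l 1 + ?l 2)"
    using G(1) M monom_degree_superset[OF _ keysM] by (simp add: homogeneous_poly_def)
  have zero: "of_nat (Suc (Poly_Mapping.lookup m i)) * (of_nat (Suc (Poly_Mapping.lookup (m + Poly_Mapping.single i 1) j)) * Poly_Mapping.lookup G M) = 0"
    if ij: "i \<in> ?W" "j \<in> ?W" and m: "M = m + Poly_Mapping.single i 1 + Poly_Mapping.single j 1" for m i j
  proof -
    have "Poly_Mapping.lookup (partial_deriv i (partial_deriv j G)) m = 0"
      by (simp only: hess[rule_format, OF ij] lookup_zero)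
    thus ?thesis by (simp only: lookup_partial_deriv m)
  qed
  have nz: "Poly_Mapping.lookup G M \<noteq> 0" using M by (simp add: in_keys_iff)
  have dvd: "p dvd x * y" if "of_nat x * (of_nat y * Poly_Mapping.lookup G M) = 0" for x y
  proof -
    have "of_nat (x * y) = (0 :: 'a)" using that nz by simp
    thus ?thesis by (simp only: of_nat_eq_0_iff_char_dvd p(2))
  qed
  have mixed: "p dvd ?l i * ?l j" if ij: "i \<in> ?W" "j \<in> ?W" "i \<noteq> j" for i j
  proof (cases "?l i > 0 \<and> ?l j > 0")
    case True
    define m where "m = M - Poly_Mapping.single i 1 - Poly_Mapping.single j 1"
    have "M = m + Poly_Mapping.single i 1 + Poly_Mapping.single j 1"
      by (rule poly_mapping_eqI)
        (use True ij(3) in \<open>auto simp: m_def lookup_add lookup_minus lookup_single when_def\<close>)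
    from dvd[OF zero[OF ij(1,2) this]]
    show ?thesis using True ij(3) by (simp add: m_def lookup_add lookup_minus lookup_single)
  qed auto
  have pure: "p dvd ?l i * (?l i - 1)" if i: "i \<in> ?W" for i
  proof (cases "?l i > 1")
    case True
    define m where "m = M - Poly_Mapping.single i 1 - Poly_Mapping.single i 1"
    have "M = m + Poly_Mapping.single i 1 + Poly_Mapping.single i 1"
      by (rule poly_mapping_eqI)
        (use True in \<open>auto simp: m_def lookup_add lookup_minus lookup_single when_def\<close>)
    from dvd[OF zero[OF i i this]]
    show ?thesis using True
      by (simp add: m_def lookup_add lookup_minus lookup_single Suc_diff_Suc numeral_2_eq_2 mult.commute)
  next
    case False
    hence "?l i = 0 \<or> ?l i = 1" by linarith
    thus ?thesis by auto
  qed
  have "\<exists>i\<in>?W. \<not> p dvd ?l i"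
  proof (rule ccontr)
    assume "\<not> (\<exists>i\<in>?W. \<not> p dvd ?l i)"
    hence "p dvd ?l 0" "p dvd ?l 1" "p dvd ?l 2" by auto
    hence "p dvd d" unfolding d by (intro dvd_add)
    with pd show False by blast
  qed
  then obtain i where i: "i \<in> ?W" "\<not> p dvd ?l i" by blast
  have others: "p dvd ?l j" if "j \<noteq> i" for j
  proof (cases "j \<in> ?W")
    case True
    thus ?thesis using mixed[OF i(1) True] that i(2) p(1) by (auto simp: prime_dvd_mult_iff)
  next
    case False
    hence "?l j = 0" using keysM by (auto simp: in_keys_iff)
    thus ?thesis by simp
  qed
  have pos: "?l i > 0" using i(2) by (cases "?l i = 0") auto
  have self: "p dvd ?l i - 1" using pure[OF i(1)] i(2) p(1) by (auto simp: prime_dvd_mult_iff)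
  have "d = (\<Sum>j\<in>?W. ?l j)" by (simp add: d)
  also have "\<dots> = ?l i + (\<Sum>j\<in>?W - {i}. ?l j)" using i(1) by (intro sum.remove) auto
  finally have "d - 1 = (?l i - 1) + (\<Sum>j\<in>?W - {i}. ?l j)" using pos by linarith
  moreover have "p dvd (\<Sum>j\<in>?W - {i}. ?l j)" using others by (intro dvd_sum) auto
  ultimately show "p dvd d - 1" using self by simp
  show "\<exists>i\<in>?W. ?l i > 0 \<and> p dvd ?l i - 1 \<and> (\<forall>j. j \<noteq> i \<longrightarrow> p dvd ?l j)"
    using i(1) pos self others by blast
qed

text \<open>
  \<open>A i\<close> collects the monomials whose exponent at \<open>i\<close> is prime to \<open>p\<close>: dividing such a monomial by \<open>X\<^sub>i\<close> leaves
  a \<open>p\<close>-th power, whose root is formed on exponents (\<open>B\<close>) and on coefficients (\<open>rt\<close>).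
\<close>

lemma zero_hessian_decomposition:
  fixes G :: "'a::{field,finite} mpoly"
  assumes p: "prime p" "CHAR('a) = p"
    and G: "homogeneous_poly d G" "poly_vars G \<subseteq> {0,1,2}" and pd: "\<not> p dvd d"
    and hess: "\<forall>i\<in>{0,1,2}. \<forall>j\<in>{0,1,2}. partial_deriv i (partial_deriv j G) = 0"
  obtains A :: "nat \<Rightarrow> 'a mpoly" where
    "\<And>i. i \<in> {0,1,2} \<Longrightarrow> poly_vars (A i) \<subseteq> {0,1,2} \<and> homogeneous_poly ((d - 1) div p) (A i)"
    "G = (\<Sum>i\<in>{0,1,2}. A i ^ p * Var i)"
proof -
  let ?W = "{0,1,2::nat}"
  have p0: "p > 0" using p(1) by (simp add: prime_gt_0_nat)
  note exps = exponents_of_zero_hessian(1)[OF p G pd hess]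
  define rt where "rt c = (SOME b. b ^ p = c)" for c :: 'a
  have rt: "rt c ^ p = c" for c unfolding rt_def using pth_root_exists[OF p, of c] by (rule someI_ex)
  define S where "S i = {M \<in> Poly_Mapping.keys G. \<not> p dvd Poly_Mapping.lookup M i}" for i
  define B where "B i M = Poly_Mapping.map (\<lambda>n. n div p) (M - Poly_Mapping.single i 1)"
    for i and M :: "nat \<Rightarrow>\<^sub>0 nat"
  define A where "A i = (\<Sum>M\<in>S i. Poly_Mapping.single (B i M) (rt (Poly_Mapping.lookup G M)))" for i
  have pB: "Poly_Mapping.map ((*) p) (B i M) + Poly_Mapping.single i 1 = M"
    and S_only: "\<And>j. M \<in> S j \<Longrightarrow> j = i" if i: "i \<in> ?W" and M: "M \<in> S i" for i M
  proof -
    have MG: "M \<in> Poly_Mapping.keys G" "\<not> p dvd Poly_Mapping.lookup M i" using M by (auto simp: S_def)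
    obtain k where k: "k \<in> ?W" "Poly_Mapping.lookup M k > 0" "p dvd Poly_Mapping.lookup M k - 1"
      "\<And>j. j \<noteq> k \<Longrightarrow> p dvd Poly_Mapping.lookup M j" using exps[OF MG(1)] by blast
    have ki: "k = i" using k(4)[of i] MG(2) by blast
    show "j = i" if "M \<in> S j" for j using that k(4)[of j] ki by (auto simp: S_def)
    show "Poly_Mapping.map ((*) p) (B i M) + Poly_Mapping.single i 1 = M"
    proof (rule poly_mapping_eqI)
      fix j
      have "p dvd Poly_Mapping.lookup (M - Poly_Mapping.single i 1) j"
        using k(3) k(4)[of j] ki by (cases "j = i") (simp_all add: lookup_minus lookup_single)
      hence "Poly_Mapping.lookup (Poly_Mapping.map ((*) p) (B i M)) j
          = Poly_Mapping.lookup (M - Poly_Mapping.single i 1) j"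
        by (simp add: lookup_map B_def)
      thus "Poly_Mapping.lookup (Poly_Mapping.map ((*) p) (B i M) + Poly_Mapping.single i 1) j
          = Poly_Mapping.lookup M j"
        using k(2) ki by (auto simp: lookup_add lookup_minus lookup_single when_def)
    qed
  qed
  have Apow: "A i ^ p * Var i = (\<Sum>M\<in>S i. Poly_Mapping.single M (Poly_Mapping.lookup G M))"
    if i: "i \<in> ?W" for i
  proof -
    have "A i ^ p = (\<Sum>M\<in>S i. Poly_Mapping.single (B i M) (rt (Poly_Mapping.lookup G M)) ^ p)"
      unfolding A_def by (rule freshmans_dream_sum) (simp_all add: CHAR_mpoly p)
    also have "\<dots> * Var i = (\<Sum>M\<in>S i. Poly_Mapping.single M (Poly_Mapping.lookup G M))"
      unfolding sum_distrib_right single_power rt Var_def mult_single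
      using pB[OF i] by (intro sum.cong refl) simp
    finally show ?thesis .
  qed
  have vars_hom: "poly_vars (A i) \<subseteq> ?W \<and> homogeneous_poly ((d - 1) div p) (A i)" if i: "i \<in> ?W" for i
  proof -
    have keysA: "\<exists>M\<in>S i. m = B i M" if m: "m \<in> Poly_Mapping.keys (A i)" for m
    proof -
      have "Poly_Mapping.lookup (A i) m \<noteq> 0" using m by (simp add: in_keys_iff)
      then obtain M where "M \<in> S i"
        "Poly_Mapping.lookup (Poly_Mapping.single (B i M) (rt (Poly_Mapping.lookup G M))) m \<noteq> 0"
        unfolding A_def lookup_sum by (meson sum.not_neutral_contains_not_neutral)
      thus ?thesis by (auto simp: lookup_single when_def split: if_splits)
    qed
    have good: "Poly_Mapping.keys (B i M) \<subseteq> ?W \<and> monom_degree (B i M) = (d - 1) div p" if M: "M \<in> S i" for M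
    proof -
      have MG: "M \<in> Poly_Mapping.keys G" using M by (simp add: S_def)
      have keysM: "Poly_Mapping.keys M \<subseteq> ?W" using MG G(2) by (auto simp: poly_vars_def)
      have "Poly_Mapping.keys (B i M) \<subseteq> Poly_Mapping.keys M"
        by (rule subsetI, rule ccontr) (auto simp: B_def in_keys_iff lookup_map lookup_minus)
      hence keysB: "Poly_Mapping.keys (B i M) \<subseteq> ?W" using keysM by blast
      have keyspB: "Poly_Mapping.keys (Poly_Mapping.map ((*) p) (B i M)) \<subseteq> ?W"
        by (rule subset_trans[OF _ keysB]) (auto simp: in_keys_iff lookup_map)
      have "d = monom_degree (Poly_Mapping.map ((*) p) (B i M) + Poly_Mapping.single i 1)"
        using pB[OF i M] MG G(1) by (simp add: homogeneous_poly_def)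
      also have "\<dots> = monom_degree (Poly_Mapping.map ((*) p) (B i M)) + 1"
        by (simp add: monom_degree_add)
      also have "monom_degree (Poly_Mapping.map ((*) p) (B i M)) = p * monom_degree (B i M)"
        using monom_degree_superset[OF _ keyspB] monom_degree_superset[OF _ keysB]
        by (simp add: lookup_map distrib_left)
      finally have "monom_degree (B i M) = (d - 1) div p" using p0 by simp
      with keysB show ?thesis by blast
    qed
    show ?thesis
      using keysA good unfolding poly_vars_def homogeneous_poly_def by fast
  qed
  have "G = (\<Sum>M\<in>Poly_Mapping.keys G. Poly_Mapping.single M (Poly_Mapping.lookup G M))"
    by (rule sum_monomials[symmetric])
  also have "\<dots> = (\<Sum>M\<in>Poly_Mapping.keys G. \<Sum>i\<in>?W.
      if M \<in> S i then Poly_Mapping.single M (Poly_Mapping.lookup G M) else 0)"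
  proof (rule sum.cong[OF refl])
    fix M assume M: "M \<in> Poly_Mapping.keys G"
    obtain k where k: "k \<in> ?W" "Poly_Mapping.lookup M k > 0" "p dvd Poly_Mapping.lookup M k - 1"
      using exps[OF M] by blast
    have "\<not> p dvd Poly_Mapping.lookup M k"
    proof
      assume "p dvd Poly_Mapping.lookup M k"
      hence "p dvd Poly_Mapping.lookup M k - (Poly_Mapping.lookup M k - 1)" using k(3) by (rule dvd_diff_nat)
      thus False using k(2) p(1) by (simp add: prime_nat_iff)
    qed
    hence kS: "M \<in> S k" using M by (simp add: S_def)
    have S_iff: "M \<in> S i \<longleftrightarrow> i = k" for i using S_only[OF k(1) kS, of i] kS by blast
    have "(\<Sum>i\<in>?W. if M \<in> S i then Poly_Mapping.single M (Poly_Mapping.lookup G M) else 0)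
        = (\<Sum>i\<in>?W. if i = k then Poly_Mapping.single M (Poly_Mapping.lookup G M) else 0)"
      by (simp only: S_iff)
    also have "\<dots> = Poly_Mapping.single M (Poly_Mapping.lookup G M)"
      using k(1) by (subst sum.delta) auto
    finally show "Poly_Mapping.single M (Poly_Mapping.lookup G M) = (\<Sum>i\<in>?W.
      if M \<in> S i then Poly_Mapping.single M (Poly_Mapping.lookup G M) else 0)" by (rule sym)
  qed
  also have "\<dots> = (\<Sum>i\<in>?W. \<Sum>M\<in>Poly_Mapping.keys G.
      if M \<in> S i then Poly_Mapping.single M (Poly_Mapping.lookup G M) else 0)"
    by (rule sum.swap)
  also have "\<dots> = (\<Sum>i\<in>?W. \<Sum>M\<in>S i. Poly_Mapping.single M (Poly_Mapping.lookup G M))"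
    by (intro sum.cong refl sum.mono_neutral_cong_right) (auto simp: S_def)
  also have "\<dots> = (\<Sum>i\<in>?W. A i ^ p * Var i)"
    using Apow by (intro sum.cong refl) simp
  finally show ?thesis using that[of A] vars_hom by blast
qed

lemma lookup_to_ac_poly: "Poly_Mapping.lookup (to_ac_poly P) m = to_ac (Poly_Mapping.lookup P m)"
  by (simp add: to_ac_poly_def lookup_map)

lemma keys_to_ac_poly: "Poly_Mapping.keys (to_ac_poly P) = Poly_Mapping.keys P"
  by (auto simp: in_keys_iff lookup_to_ac_poly)

lemma partial_deriv_to_ac_poly: "partial_deriv i (to_ac_poly P) = to_ac_poly (partial_deriv i P)"
  by (rule poly_mapping_eqI) (simp add: lookup_partial_deriv lookup_to_ac_poly del: of_nat_Suc)

lemma partial_deriv_add: "partial_deriv i (P + Q) = partial_deriv i P + partial_deriv i Q"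
  by (rule poly_mapping_eqI) (simp add: lookup_partial_deriv lookup_add distrib_left del: of_nat_Suc)

lemma partial_deriv_sum: "partial_deriv i (sum f A) = (\<Sum>x\<in>A. partial_deriv i (f x))"
  by (induction A rule: infinite_finite_induct) (simp_all add: partial_deriv_add)

lemma partial_deriv_single_var_power:
  "partial_deriv j (Poly_Mapping.single (Poly_Mapping.single i d) c)
    = (if i = j then Poly_Mapping.single (Poly_Mapping.single i (d - 1)) (of_nat d * c) else 0)"
  by (cases "d = 0 \<or> c = 0") (auto simp: partial_deriv_def lookup_single when_def single_diff[symmetric])

lemma eval_poly_add: "eval_poly x (P + Q) = eval_poly x P + eval_poly x Q"
  unfolding eval_poly_eq_eval_in by (rule eval_in_add) simp_all

lemma eval_poly_sum: "eval_poly x (sum f A) = (\<Sum>a\<in>A. eval_poly x (f a))"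
  unfolding eval_poly_eq_eval_in by (rule eval_in_sum) simp_all

lemma eval_poly_single: "eval_poly x (Poly_Mapping.single m c) = c * monom_val x m"
  unfolding eval_poly_eq_eval_in by (rule eval_in_single) simp

lemma partial_deriv_not_in_vars:
  assumes "i \<notin> poly_vars P"
  shows "partial_deriv i P = 0"
proof -
  have "Poly_Mapping.lookup m i = 0" if "m \<in> Poly_Mapping.keys P" for m
    using assms that by (auto simp: poly_vars_def in_keys_iff)
  thus ?thesis by (simp add: partial_deriv_def)
qed


section \<open>Frobenius nonclassical hypersurfaces\<close>

theorem proposition4p4:
  fixes n p q e d :: nat
    and F G :: "'a::{field,finite} mpoly"
    and a :: "nat \<Rightarrow> 'a"
  assumes "n \<ge> 3"
    and "prime p" and "p > 3"
    and "e > 0" and "q = p ^ e" and "card (UNIV :: 'a set) = q"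
    and "d > 2"
    and "poly_vars F \<subseteq> {0..n}" and "homogeneous_poly d F"
    and "absolutely_irreducible F"
    and "poly_vars G \<subseteq> {0, 1, 2}"
    and "F = G + (\<Sum>i=3..n. Const (a i) * Var i ^ d)"
    and "\<not> p dvd d"
    and "(\<Sum>i=0..n. partial_deriv i F * Var i ^ q) \<noteq> 0"
    and "hypersurface n (to_ac_poly F) \<inter> (\<Inter>i\<in>{3..n}. hypersurface n (Var i))
           \<subseteq> regular_locus n (to_ac_poly F)"
    and "frobenius_nonclassical q n F"
  shows "p dvd d - 1 \<and>
    (\<exists>r>0. p ^ r dvd d - 1 \<and>
      (\<exists>A B C :: 'a mpoly.
         (\<forall>H \<in> {A, B, C}. poly_vars H \<subseteq> {0, 1, 2} \<and> homogeneous_poly ((d - 1) div p ^ r) H) \<and>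
         G = A ^ (p ^ r) * Var 0 + B ^ (p ^ r) * Var 1 + C ^ (p ^ r) * Var 2))"
proof -
  let ?W = "{0,1,2::nat}"
  let ?G = "to_ac_poly G" and ?F = "to_ac_poly F"
  note n = \<open>n \<ge> 3\<close> and p = \<open>prime p\<close> and d = \<open>d > 2\<close>
  have varsG: "poly_vars G \<subseteq> ?W" by fact
  have CHAR: "CHAR('a) = p" by (rule CHAR_of_card[OF p]) (use assms(5,6) in simp)
  have of_nat_0: "of_nat k = (0 :: 'a alg_closure) \<longleftrightarrow> p dvd k" for k
    by (simp add: of_nat_eq_0_iff_char_dvd CHAR)

  define R where "R = (\<Sum>i=3..n. Poly_Mapping.single (Poly_Mapping.single i d) (a i))"
  have F: "F = G + R"
  proof -
    have "Const (a i) * Var i ^ d = Poly_Mapping.single (Poly_Mapping.single i d) (a i)" for i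
    proof -
      have "Poly_Mapping.map ((*) d) (Poly_Mapping.single i 1) = Poly_Mapping.single i d"
        by (rule poly_mapping_eqI) (simp add: lookup_map lookup_single when_def)
      thus ?thesis by (simp only: Const_def Var_def single_power power_one mult_single) simp
    qed
    thus ?thesis unfolding R_def by (simp add: assms(12))
  qed

  have homG: "homogeneous_poly d G"
    unfolding homogeneous_poly_def
  proof
    fix m assume m: "m \<in> Poly_Mapping.keys G"
    have "Poly_Mapping.lookup (Poly_Mapping.single (Poly_Mapping.single i d) (a i)) m = 0"
      if "i \<in> {3..n}" for i
    proof -
      have "i \<notin> Poly_Mapping.keys m" using m varsG that by (auto simp: poly_vars_def)
      hence "m \<noteq> Poly_Mapping.single i d" using d by (auto simp: in_keys_iff)
      thus ?thesis by (auto simp: lookup_single when_def)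
    qed
    hence "Poly_Mapping.lookup R m = 0" unfolding R_def lookup_sum by (intro sum.neutral) auto
    hence "m \<in> Poly_Mapping.keys F" using m by (simp add: F lookup_add in_keys_iff)
    thus "monom_degree m = d" using assms(9) by (simp add: homogeneous_poly_def)
  qed
  have homG': "homogeneous_poly d ?G"
    using homG by (simp add: homogeneous_poly_def keys_to_ac_poly)
  have varsG': "poly_vars ?G \<subseteq> ?W"
    using varsG by (simp add: poly_vars_def keys_to_ac_poly)

  define R' where "R' = (\<Sum>i=3..n. Poly_Mapping.single (Poly_Mapping.single i d) (to_ac (a i)))"
  have F': "?F = ?G + R'"
    by (rule poly_mapping_eqI)
      (auto simp: F R_def R'_def lookup_to_ac_poly lookup_add lookup_sum to_ac_sum lookup_single when_def
        intro!: sum.cong)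
  have evalF: "eval_poly x ?F = eval_poly x ?G"
    and evalDF: "eval_poly x (partial_deriv j ?F) = eval_poly x (partial_deriv j ?G)"
    if x: "\<And>i. i \<ge> 3 \<Longrightarrow> x i = 0" for x j
  proof -
    have "eval_poly x R' = 0"
      unfolding R'_def eval_poly_sum eval_poly_single monom_val_single
      using x d by (intro sum.neutral) (auto simp: power_0_left)
    thus "eval_poly x ?F = eval_poly x ?G" by (simp add: F' eval_poly_add)
    have "eval_poly x (partial_deriv j R') = 0"
      unfolding R'_def partial_deriv_sum partial_deriv_single_var_power eval_poly_sum
      using x d by (intro sum.neutral) (auto simp: eval_poly_single monom_val_single power_0_left eval_poly_eq_eval_in[of _ 0])
    thus "eval_poly x (partial_deriv j ?F) = eval_poly x (partial_deriv j ?G)"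
      by (simp add: F' partial_deriv_add eval_poly_add)
  qed
  have DG0: "partial_deriv j ?G = 0" if "j \<notin> ?W" for j
    using varsG' that by (intro partial_deriv_not_in_vars) auto

  have point: "(\<exists>i\<in>?W. eval_poly x (partial_deriv i ?G) \<noteq> 0) \<and>
      (\<Sum>i\<in>?W. eval_poly x (partial_deriv i ?G) * x i ^ q) = 0"
    if x0: "eval_poly x ?G = 0" "\<exists>i\<in>?W. x i \<noteq> 0" for x
  proof -
    \<comment> \<open>The value of a polynomial in \<open>X\<^sub>0, X\<^sub>1, X\<^sub>2\<close> is not affected by the other coordinates of \<open>x\<close>, so they may
      be cleared to obtain a point of the section.\<close>
    define y where "y i = (if i \<in> ?W then x i else 0)" for i
    have yx: "eval_poly y P = eval_poly x P" if "poly_vars P \<subseteq> ?W" for P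
      unfolding eval_poly_eq_eval_in using that by (intro eval_in_cong) (auto simp: y_def)
    have y3: "y i = 0" if "i \<ge> 3" for i using that by (simp add: y_def)
    have y: "y \<in> hom_coords n"
    proof -
      from x0(2) obtain i where i: "i \<in> ?W" "x i \<noteq> 0" by blast
      hence "i \<le> n" "y i \<noteq> 0" using n by (auto simp: y_def)
      moreover have "y i = 0" if "i > n" for i using that n by (simp add: y_def)
      ultimately show ?thesis unfolding hom_coords_def by blast
    qed
    define P where "P = proportional n `` {y}"
    have P: "P \<in> proj_space n" using y by (simp add: P_def proj_space_def quotientI)
    have yP: "y \<in> P" unfolding P_def by (rule equiv_class_self[OF equiv_proportional y])
    have Pz: "\<exists>c. z = (\<lambda>i. c * y i)" if "z \<in> P" for z
      using that unfolding P_def proportional_def by blast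
    have "P \<in> hypersurface n ?F"
      unfolding hypersurface_def
    proof (intro CollectI conjI ballI P)
      fix z assume "z \<in> P"
      then obtain c where c: "z = (\<lambda>i. c * y i)" using Pz by blast
      have "eval_poly z ?F = eval_poly z ?G" by (rule evalF) (simp add: c y3)
      also have "\<dots> = c ^ d * eval_poly y ?G" unfolding c by (rule eval_poly_scale[OF homG'])
      finally show "eval_poly z ?F = 0" using x0(1) yx[OF varsG'] by simp
    qed
    moreover have "P \<in> hypersurface n (Var i)" if "i \<in> {3..n}" for i
      unfolding hypersurface_def
    proof (intro CollectI conjI ballI P)
      fix z assume "z \<in> P"
      then obtain c where c: "z = (\<lambda>i. c * y i)" using Pz by blast
      show "eval_poly z (Var i) = 0"
        unfolding Var_def eval_poly_single monom_val_single using that by (simp add: c y3)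
    qed
    ultimately have reg: "P \<in> regular_locus n ?F" using assms(15) by blast
    have Dyx: "eval_poly y (partial_deriv i ?F) = eval_poly x (partial_deriv i ?G)" for i
    proof -
      have "eval_poly y (partial_deriv i ?F) = eval_poly y (partial_deriv i ?G)"
        by (rule evalDF) (rule y3)
      also have "\<dots> = eval_poly x (partial_deriv i ?G)"
        by (rule yx[OF subset_trans[OF poly_vars_partial_deriv varsG']])
      finally show ?thesis .
    qed
    have zero: "eval_poly x (partial_deriv i ?G) = 0" if "i \<notin> ?W" for i
      using that by (simp add: DG0 eval_poly_eq_eval_in)
    from reg yP obtain i where "eval_poly y (partial_deriv i ?F) \<noteq> 0"
      unfolding regular_locus_def by blast
    hence "\<exists>i\<in>?W. eval_poly x (partial_deriv i ?G) \<noteq> 0" using Dyx zero by metis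
    moreover have "frobenius_map q P \<in> tangent_hyperplane n ?F P"
      using assms(16) reg unfolding frobenius_nonclassical_def by blast
    hence "(\<Sum>i\<le>n. eval_poly y (partial_deriv i ?F) * y i ^ q) = 0"
      using yP unfolding tangent_hyperplane_def frobenius_map_def by auto
    moreover have "(\<Sum>i\<in>?W. eval_poly x (partial_deriv i ?G) * x i ^ q)
        = (\<Sum>i\<le>n. eval_poly y (partial_deriv i ?F) * y i ^ q)"
      unfolding Dyx using n zero by (intro sum.mono_neutral_cong_left) (auto simp: y_def)
    ultimately show ?thesis by simp
  qed

  have hess': "partial_deriv i (partial_deriv j ?G) = 0" if "i \<in> ?W" "j \<in> ?W" for i j
  proof (rule smooth_frobenius_nonclassical_curve_hessian[OF homG' varsG'])
    show "d \<ge> 2" using d by simp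
    show "of_nat d \<noteq> (0 :: 'a alg_closure)" using assms(13) by (simp add: of_nat_0)
    have "\<not> p dvd 2" using assms(3) by (auto dest: dvd_imp_le)
    thus "(2 :: 'a alg_closure) \<noteq> 0" using of_nat_0[of 2] by simp
    show "q > 1" unfolding assms(5) by (rule one_less_power) (use assms(3,4) in auto)
    show "of_nat q = (0 :: 'a alg_closure)" unfolding of_nat_0 using assms(4,5) by simp
  qed (use point that in blast)+
  have hess: "\<forall>i\<in>?W. \<forall>j\<in>?W. partial_deriv i (partial_deriv j G) = 0"
  proof (intro ballI)
    fix i j assume "i \<in> ?W" "j \<in> ?W"
    hence "to_ac_poly (partial_deriv i (partial_deriv j G)) = 0"
      using hess' by (simp only: partial_deriv_to_ac_poly)
    hence "to_ac (Poly_Mapping.lookup (partial_deriv i (partial_deriv j G)) m) = 0" for m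
      by (simp flip: lookup_to_ac_poly)
    thus "partial_deriv i (partial_deriv j G) = 0" by (intro poly_mapping_eqI) simp
  qed

  have "G \<noteq> 0"
  proof
    assume "G = 0"
    hence "?G = 0" by (simp add: to_ac_poly_def poly_mapping_eq_iff lookup_map fun_eq_iff)
    hence "(\<exists>i\<in>?W. eval_poly (\<lambda>_. 1) (partial_deriv i ?G) \<noteq> 0)"
      using point[of "\<lambda>_. 1"] by (auto simp: eval_poly_eq_eval_in)
    thus False using \<open>?G = 0\<close> by (simp add: eval_poly_eq_eval_in)
  qed
  then obtain M where "M \<in> Poly_Mapping.keys G" by fastforce
  from exponents_of_zero_hessian(2)[OF p CHAR homG varsG assms(13) hess this]
  have pd: "p dvd d - 1" .

  obtain A where A: "\<And>i. i \<in> ?W \<Longrightarrow> poly_vars (A i) \<subseteq> ?W \<and> homogeneous_poly ((d - 1) div p) (A i)"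
    "G = (\<Sum>i\<in>?W. A i ^ p * Var i)"
    using zero_hessian_decomposition[OF p CHAR homG varsG assms(13) hess] by blast
  have "(\<forall>H\<in>{A 0, A 1, A 2}. poly_vars H \<subseteq> ?W \<and> homogeneous_poly ((d - 1) div p ^ 1) H) \<and>
      G = A 0 ^ (p ^ 1) * Var 0 + A 1 ^ (p ^ 1) * Var 1 + A 2 ^ (p ^ 1) * Var 2"
    using A(1) by (subst A(2)) (simp add: add.assoc)
  moreover have "p ^ 1 dvd d - 1" using pd by simp
  ultimately show ?thesis using pd zero_less_one by blast
qed

end
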